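(* Let $J$ be an $AD$ tree with $n$ elements $D_1,\dots,D_n$ forming an instance of the XML reconstruction view selection problem with integer parameters, and let $a(n)$ be such that $\sum_{i=1}^n a_i\,COST_R(D_i)\le a(n)$. Then there is an approximation scheme which, for every $\epsilon$ with $0<\epsilon<1$, computes a $(1+\epsilon)$-approximate solution (a selection satisfying the capacity constraint whose cost saving is within a factor $1+\epsilon$ of the optimum) in time $O\!\left(n\left(\frac{(\log \chi(J))(\log a(n))}{\epsilon}\right)^{2}\right)$.
   Context: XML reconstruction view selection problem: given elements $D=\{D_1,\dots,D_n\}$ arranged as a rooted tree $J$ (the $AD$ tree, each edge joining a parent and child element; $(D_j,D_i)\in AD$ means $D_j$ is an ancestor of $D_i$), for each $i$ a size $size(D_i)>0$ (strictly smaller than the size of each ancestor), an access frequency $a_i$, access costs $COST_A(D_i)<COST_R(D_i)$, and a capacity $\delta\ge0$, select $M\subseteq D$ with $\sum_{D_i\in M}size(D_i)\le\delta$ maximizing $\lambda(D,M)=\sum_{D_i\in M^+}a_i(COST_R(D_i)-COST_A(D_i))$, where $M^+$ is the set of elements of $M$ together with all their descendants. All parameters are assumed to be integers. $\chi(J)$ denotes the largest product of the node degrees along a path from the root to a leaf in $J$.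
   Formalization: The time bound is n·max(1, (log χ(J))(log a(n))/ε)² up to a constant, since the stated bound is 0 when χ(J)=1 or a(n)=1 (e.g. a path); it is unchanged when χ(J)≥2 and a(n)≥2. Frequencies and access costs are taken nonnegative. *)

theory Defs
  imports Complex_Main
begin

section \<open>The XML reconstruction view selection problem\<close>

datatype 'a rtree = Node (root_label: 'a) (children: "'a rtree list")

fun labels :: "'a rtree \<Rightarrow> 'a list" where
  "labels (Node x ts) = x # concat (map labels ts)"

fun subtrees :: "'a rtree \<Rightarrow> 'a rtree set" where
  "subtrees (Node x ts) = insert (Node x ts) (\<Union>t\<in>set ts. subtrees t)"

definition parent_child :: "'a rtree \<Rightarrow> ('a \<times> 'a) set" where
  "parent_child J = {(x, root_label t) | x ts t. Node x ts \<in> subtrees J \<and> t \<in> set ts}"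

text \<open>The pair \<open>(j, i)\<close> belongs to the relation iff \<open>j\<close> is a proper ancestor of \<open>i\<close>.\<close>

definition AD :: "'a rtree \<Rightarrow> ('a \<times> 'a) set" where
  "AD J = (parent_child J)\<^sup>+"

text \<open>
  For every path from the root to a leaf, the list of the node degrees (numbers of children) along
  it. The leaf itself, whose degree 0 would annihilate every product, is left out.
\<close>

fun path_degrees :: "'a rtree \<Rightarrow> nat list list" where
  "path_degrees (Node x ts) =
     (if ts = [] then [[]] else map (Cons (length ts)) (concat (map path_degrees ts)))"

definition chi :: "'a rtree \<Rightarrow> nat" where
  "chi J = Max (prod_list ` set (path_degrees J))"

record view_instance =
  ad_tree :: "nat rtree"
  elem_size :: "nat \<Rightarrow> int"
  freq :: "nat \<Rightarrow> int"
  cost_R :: "nat \<Rightarrow> int"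
  cost_A :: "nat \<Rightarrow> int"
  capacity :: int

definition num_elems :: "view_instance \<Rightarrow> nat" where
  "num_elems I = length (labels (ad_tree I))"

text \<open>The element \<open>D\<^sub>i\<close> is represented by its index \<open>i\<close>.\<close>

definition elems :: "view_instance \<Rightarrow> nat set" where
  "elems I = {1..num_elems I}"

definition valid_instance :: "view_instance \<Rightarrow> bool" where
  "valid_instance I \<longleftrightarrow>
     distinct (labels (ad_tree I)) \<and> set (labels (ad_tree I)) = elems I \<and>
     (\<forall>i\<in>elems I. 0 < elem_size I i \<and> 0 \<le> freq I i \<and> 0 \<le> cost_A I i \<and> cost_A I i < cost_R I i) \<and>
     (\<forall>(j, i)\<in>AD (ad_tree I). elem_size I i < elem_size I j) \<and>
     0 \<le> capacity I"

definition plus_closure :: "view_instance \<Rightarrow> nat set \<Rightarrow> nat set" where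
  "plus_closure I M = M \<union> AD (ad_tree I) `` M"

definition saving :: "view_instance \<Rightarrow> nat set \<Rightarrow> int" where
  "saving I M = (\<Sum>i\<in>plus_closure I M. freq I i * (cost_R I i - cost_A I i))"

definition feasible :: "view_instance \<Rightarrow> nat set \<Rightarrow> bool" where
  "feasible I M \<longleftrightarrow> M \<subseteq> elems I \<and> (\<Sum>i\<in>M. elem_size I i) \<le> capacity I"

definition opt_saving :: "view_instance \<Rightarrow> int" where
  "opt_saving I = Max (saving I ` {M. feasible I M})"

definition approx_solution :: "view_instance \<Rightarrow> real \<Rightarrow> nat set \<Rightarrow> bool" where
  "approx_solution I \<epsilon> M \<longleftrightarrow>
     feasible I M \<and> real_of_int (opt_saving I) \<le> (1 + \<epsilon>) * real_of_int (saving I M)"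


section \<open>The model of computation\<close>

text \<open>
  Running time is the number of evaluation steps of a program in a first-order, call-by-value
  functional language over integers and cons cells. A step (allocating or inspecting one cell,
  an arithmetic operation, a comparison, a variable access, a call) is a constant number of steps of
  a random access machine, since for a fixed program all environments have bounded length.

  So that unit cost is legitimate, evaluation is relative to a word bound \<open>W\<close>: it is stuck as soon
  as an operation produces an integer of absolute value above \<open>W\<close>.
\<close>

datatype val = IntV int | NilV | ConsV val val

datatype arith_op = Add | Sub | Mul | Div

text \<open>
  Variables are de Bruijn indices. \<open>IfLess a b c d\<close> evaluates \<open>c\<close> if \<open>a < b\<close> and \<open>d\<close> otherwise;
  \<open>CaseList a b c\<close> evaluates \<open>b\<close> if \<open>a\<close> is nil, and otherwise \<open>c\<close> with the head and the tail of
  \<open>a\<close> as variables 0 and 1; \<open>LetE a b\<close> binds the value of \<open>a\<close> to variable 0 in \<open>b\<close>.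
\<close>

datatype expr =
    Var nat
  | Lit int
  | NilE
  | ConsE expr expr
  | Arith arith_op expr expr
  | IfLess expr expr expr expr
  | CaseList expr expr expr
  | LetE expr expr
  | Call nat "expr list"

text \<open>
  A program is a list of bodies of mutually recursive functions; the arguments of a call are the
  initial environment of the body. Function 0 is the entry point.
\<close>

type_synonym prog = "expr list"

fun arith :: "arith_op \<Rightarrow> int \<Rightarrow> int \<Rightarrow> int" where
  "arith Add x y = x + y"
| "arith Sub x y = x - y"
| "arith Mul x y = x * y"
| "arith Div x y = x div y"

inductive eval :: "int \<Rightarrow> prog \<Rightarrow> val list \<Rightarrow> expr \<Rightarrow> val \<Rightarrow> nat \<Rightarrow> bool"
  and evals :: "int \<Rightarrow> prog \<Rightarrow> val list \<Rightarrow> expr list \<Rightarrow> val list \<Rightarrow> nat \<Rightarrow> bool"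
  for W :: int and P :: prog where
  Var: "i < length env \<Longrightarrow> eval W P env (Var i) (env ! i) 1"
| Lit: "\<bar>c\<bar> \<le> W \<Longrightarrow> eval W P env (Lit c) (IntV c) 1"
| NilE: "eval W P env NilE NilV 1"
| ConsE: "eval W P env a u s \<Longrightarrow> eval W P env b v t \<Longrightarrow>
    eval W P env (ConsE a b) (ConsV u v) (s + t + 1)"
| Arith: "eval W P env a (IntV x) s \<Longrightarrow> eval W P env b (IntV y) t \<Longrightarrow> \<bar>arith f x y\<bar> \<le> W \<Longrightarrow>
    eval W P env (Arith f a b) (IntV (arith f x y)) (s + t + 1)"
| IfLess_true: "eval W P env a (IntV x) s \<Longrightarrow> eval W P env b (IntV y) t \<Longrightarrow> x < y \<Longrightarrow>
    eval W P env c v r \<Longrightarrow> eval W P env (IfLess a b c d) v (s + t + r + 1)"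
| IfLess_false: "eval W P env a (IntV x) s \<Longrightarrow> eval W P env b (IntV y) t \<Longrightarrow> \<not> x < y \<Longrightarrow>
    eval W P env d v r \<Longrightarrow> eval W P env (IfLess a b c d) v (s + t + r + 1)"
| CaseList_nil: "eval W P env a NilV s \<Longrightarrow> eval W P env b v t \<Longrightarrow>
    eval W P env (CaseList a b c) v (s + t + 1)"
| CaseList_cons: "eval W P env a (ConsV x y) s \<Longrightarrow> eval W P (x # y # env) c v t \<Longrightarrow>
    eval W P env (CaseList a b c) v (s + t + 1)"
| LetE: "eval W P env a u s \<Longrightarrow> eval W P (u # env) b v t \<Longrightarrow>
    eval W P env (LetE a b) v (s + t + 1)"
| Call: "f < length P \<Longrightarrow> evals W P env as us s \<Longrightarrow> eval W P us (P ! f) v t \<Longrightarrow>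
    eval W P env (Call f as) v (s + t + 1)"
| evals_Nil: "evals W P env [] [] 0"
| evals_Cons: "eval W P env a u s \<Longrightarrow> evals W P env as us t \<Longrightarrow>
    evals W P env (a # as) (u # us) (s + t)"

inductive_cases eval_VarE: "eval W P env (Var i) v t"
inductive_cases eval_LitE: "eval W P env (Lit c) v t"
inductive_cases eval_NilEE: "eval W P env (NilE) v t"
inductive_cases eval_ConsEE: "eval W P env (ConsE a b) v t"
inductive_cases eval_ArithE: "eval W P env (Arith f a b) v t"
inductive_cases eval_IfLessE: "eval W P env (IfLess a b c d) v t"
inductive_cases eval_CaseListE: "eval W P env (CaseList a b c) v t"
inductive_cases eval_LetEE: "eval W P env (LetE a b) v t"
inductive_cases eval_CallE: "eval W P env (Call f as) v t"
inductive_cases evals_NilE: "evals W P env [] vs t"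
inductive_cases evals_ConsE: "evals W P env (a # as) vs t"

lemma eval_deterministic:
  "eval W P env e v t \<Longrightarrow> (\<And>v' t'. eval W P env e v' t' \<Longrightarrow> v' = v \<and> t' = t)"
  "evals W P env es vs t \<Longrightarrow> (\<And>vs' t'. evals W P env es vs' t' \<Longrightarrow> vs' = vs \<and> t' = t)"
proof (induction rule: eval_evals.inducts)
  case (Var i env)
  from Var.prems show ?case by (rule eval_VarE) simp_all
next
  case (Lit c env)
  from Lit.prems show ?case by (rule eval_LitE) simp_all
next
  case (NilE env)
  from NilE.prems show ?case by (rule eval_NilEE) simp_all
next
  case (ConsE env a u s b v t)
  from ConsE.prems show ?case by (rule eval_ConsEE) (fastforce dest: ConsE.IH(2) ConsE.IH(4))+
next
  case (Arith env a x s b y t f)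
  from Arith.prems show ?case by (rule eval_ArithE) (fastforce dest: Arith.IH(2) Arith.IH(4))+
next
  case (IfLess_true env a x s b y t c v r d)
  from IfLess_true.prems show ?case by (rule eval_IfLessE) (use IfLess_true.hyps in \<open>fastforce dest: IfLess_true.IH(2) IfLess_true.IH(4) IfLess_true.IH(6)\<close>)+
next
  case (IfLess_false env a x s b y t d v r c)
  from IfLess_false.prems show ?case by (rule eval_IfLessE) (use IfLess_false.hyps in \<open>fastforce dest: IfLess_false.IH(2) IfLess_false.IH(4) IfLess_false.IH(6)\<close>)+
next
  case (CaseList_nil env a s b v t c)
  from CaseList_nil.prems show ?case by (rule eval_CaseListE) (fastforce dest: CaseList_nil.IH(2) CaseList_nil.IH(4))+
next
  case (CaseList_cons env a x y s c v t b)
  from CaseList_cons.prems show ?case by (rule eval_CaseListE) (fastforce dest: CaseList_cons.IH(2) CaseList_cons.IH(4))+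
next
  case (LetE env a u s b v t)
  from LetE.prems show ?case by (rule eval_LetEE) (fastforce dest: LetE.IH(2) LetE.IH(4))+
next
  case (Call f env as us s v t)
  from Call.prems show ?case by (rule eval_CallE) (fastforce dest: Call.IH(3) Call.IH(5))+
next
  case (evals_Nil env)
  from evals_Nil.prems show ?case by (rule evals_NilE) simp_all
next
  case (evals_Cons env a u s as us t)
  from evals_Cons.prems show ?case by (rule evals_ConsE) (fastforce dest: evals_Cons.IH(2) evals_Cons.IH(4))+
qed

definition run :: "int \<Rightarrow> prog \<Rightarrow> val list \<Rightarrow> val \<Rightarrow> nat \<Rightarrow> bool" where
  "run W P args v t \<longleftrightarrow> 0 < length P \<and> eval W P args (P ! 0) v t"

fun max_int :: "val \<Rightarrow> int" where
  "max_int (IntV x) = \<bar>x\<bar>"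
| "max_int NilV = 0"
| "max_int (ConsV u v) = max (max_int u) (max_int v)"

text \<open>
  Words of \<open>k * log 2 (2 + m)\<close> bits, where \<open>m\<close> is the largest integer (in absolute value) occurring
  in the input.
\<close>

definition word_bound :: "nat \<Rightarrow> val list \<Rightarrow> int" where
  "word_bound k args = (2 + Max (max_int ` set args)) ^ k"


section \<open>Representation of inputs and outputs\<close>

fun list_val :: "val list \<Rightarrow> val" where
  "list_val [] = NilV"
| "list_val (v # vs) = ConsV v (list_val vs)"

fun tree_val :: "view_instance \<Rightarrow> nat rtree \<Rightarrow> val" where
  "tree_val I (Node i ts) =
     ConsV (list_val (map IntV [int i, elem_size I i, freq I i, cost_R I i, cost_A I i]))
           (list_val (map (tree_val I) ts))"

text \<open>
  The accuracy enters the computation as a fraction of integers. A real number need not be such a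
  fraction, so any fraction of the same order of magnitude and not exceeding it is admitted; for
  rational \<open>\<epsilon>\<close> this includes \<open>\<epsilon>\<close> itself.
\<close>

definition represents_accuracy :: "nat \<Rightarrow> nat \<Rightarrow> real \<Rightarrow> bool" where
  "represents_accuracy p q \<epsilon> \<longleftrightarrow> 0 < q \<and> \<epsilon> / 2 \<le> real p / real q \<and> real p / real q \<le> \<epsilon>"

definition input_vals :: "view_instance \<Rightarrow> nat \<Rightarrow> nat \<Rightarrow> val list" where
  "input_vals I p q =
     [tree_val I (ad_tree I), IntV (capacity I), IntV (int p), IntV (int q)]"

definition output_val :: "nat list \<Rightarrow> val" where
  "output_val xs = list_val (map (\<lambda>i. IntV (int i)) xs)"

text \<open>
  Constants in \<open>O\<close>-bounds are uniform in all parameters. The bound is the literal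
  \<open>n * (log chi * log a / \<epsilon>)\<^sup>2\<close> whenever both logarithms (here \<open>A\<close> is the value \<open>a(n)\<close>) are at least 1.
  The maximum with 1 concerns the degenerate cases only, such as a tree without branching, where the
  logarithm vanishes although the input of length proportional to \<open>n\<close> still has to be read.
\<close>

definition time_bound :: "nat \<Rightarrow> nat \<Rightarrow> real \<Rightarrow> real \<Rightarrow> real" where
  "time_bound n x A \<epsilon> = real n * (max 1 (log 2 (real x) * log 2 A / \<epsilon>))\<^sup>2"

end

theory Submission
  imports Defs
begin

text \<open>
  Savings are rounded down to a grid \<open>0 = g\<^sub>0 < g\<^sub>1 < \<dots>\<close> with \<open>g\<^sub>k\<^sub>+\<^sub>1 = g\<^sub>k + 1 + g\<^sub>k div d\<close>, so that every
  integer \<open>v\<close> has a grid point \<open>g \<le> v \<le> (1 + 1 / d) * g\<close>. For every subtree, dynamic programming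
  computes, for each grid point, a cheap selection whose saving is at least that grid point. Two
  tables of length \<open>K\<close> are merged in time \<open>O(K\<^sup>2)\<close>, and the tables of the children of a node of degree
  \<open>b\<close> are merged pairwise in about \<open>log b\<close> rounds; only a merge (and the insertion of a single
  element) rounds. Hence a selection is rounded \<open>h + 1\<close> times, where \<open>h\<close> is the largest number of
  rounds along a path, and \<open>h \<le> 2 * log \<chi>\<close>. Taking \<open>d\<close> of order \<open>h / \<epsilon>\<close> gives the accuracy, and
  \<open>K = O(d * log a)\<close>. When \<open>h = 0\<close> the tree is a path, and the topmost element that fits is optimal.
\<close>

section \<open>Merging tables\<close>

text \<open>Two quantities have to be kept down: the number of roundings and the cost of a merge.
  Absorbing the children of a node one at a time could round once per child, so the degrees
  themselves would enter the error; merging in pairs lets only their logarithms enter, and along a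
  path these add up to the logarithm of the degree product. Rounding the logarithms up to integers
  costs the factor 2. A merge faces K^3 triples of two entries and a target, but costs increase
  along a table, so one sweep finds the cheapest partners of an entry for all targets, and K sweeps
  of length O(K) suffice. The root of a subtree competes with the table of its children instead of
  being added to it, since it covers the whole subtree by itself. Trees without branching are
  treated apart because log \<chi> = 0 there and the time bound is only linear in n, whatever the
  accuracy.\<close>

datatype sol = SNil | SOne nat | SJoin sol sol

text \<open>Keeping a selection as a tree of joins makes combining two selections a matter of one
  node instead of a list append. The accumulator keeps the final flattening linear in
  \<open>sol_size\<close>.\<close>

fun sol_list :: "sol \<Rightarrow> nat list \<Rightarrow> nat list" where
  "sol_list SNil acc = acc"
| "sol_list (SOne i) acc = i # acc"
| "sol_list (SJoin a b) acc = sol_list a (sol_list b acc)"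

fun sol_set :: "sol \<Rightarrow> nat set" where
  "sol_set SNil = {}"
| "sol_set (SOne i) = {i}"
| "sol_set (SJoin a b) = sol_set a \<union> sol_set b"

fun sol_size :: "sol \<Rightarrow> nat" where
  "sol_size SNil = 1"
| "sol_size (SOne i) = 1"
| "sol_size (SJoin a b) = sol_size a + sol_size b + 1"

lemma set_sol_list: "set (sol_list s acc) = sol_set s \<union> set acc"
  by (induction s acc rule: sol_list.induct) auto

text \<open>An entry is a cost with a selection. The saving it guarantees is not stored: it is the
  grid point at the same position.\<close>

type_synonym table = "(int \<times> sol) list"

text \<open>One row of a merge: \<open>x\<close>, of grid value \<open>u\<close>, is combined with
  the entries of \<open>Y\<close>, whose grid values are \<open>H\<close>; \<open>acc\<close> holds
  the best entries so far for the targets \<open>G\<close>. If \<open>u + h < g\<close>, then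
  \<open>y\<close> misses this target and all later ones and is dropped for good; otherwise it is
  the cheapest partner that reaches \<open>g\<close> and stays available for the next target. Once
  the capacity is exceeded, all later partners exceed it too. The equation with \<open>H\<close>
  exhausted before \<open>Y\<close> is a default for calls that do not arise.\<close>

fun add_shifted :: "int \<Rightarrow> int \<Rightarrow> int \<times> sol \<Rightarrow> int list \<Rightarrow> int list \<Rightarrow> table \<Rightarrow> table \<Rightarrow> table" where
  "add_shifted c u x [] H Y acc = acc"
| "add_shifted c u x (g # G) H [] acc = acc"
| "add_shifted c u x (g # G) [] (y # Y) acc = []"
| "add_shifted c u x (g # G) (h # H) (y # Y) acc =
     (if u + h < g then add_shifted c u x (g # G) H Y acc
      else if c < fst x + fst y then acc
      else case acc of
        [] \<Rightarrow> (fst x + fst y, SJoin (snd x) (snd y)) # add_shifted c u x G (h # H) (y # Y) []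
      | a # acc' \<Rightarrow>
          (if fst x + fst y < fst a then (fst x + fst y, SJoin (snd x) (snd y)) else a)
            # add_shifted c u x G (h # H) (y # Y) acc')"

text \<open>\<open>H\<close> is the grid again, but consumed together with \<open>X\<close>, so that
  its head is always the grid value of the current row; \<open>G\<close> stays whole.\<close>

fun merge_tables :: "int \<Rightarrow> int list \<Rightarrow> table \<Rightarrow> int list \<Rightarrow> table \<Rightarrow> table \<Rightarrow> table" where
  "merge_tables c G [] H Y acc = acc"
| "merge_tables c G (x # X) [] Y acc = []"
| "merge_tables c G (x # X) (h # H) Y acc =
     merge_tables c G X H Y (add_shifted c h x G G Y acc)"

text \<open>The root alone saves \<open>w\<close>, everything in its subtree, so it competes at each
  target up to \<open>w\<close> with its own size \<open>s\<close> as cost; joining it with further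
  elements would gain nothing.\<close>

fun insert_root :: "int \<Rightarrow> nat \<Rightarrow> int \<Rightarrow> int list \<Rightarrow> table \<Rightarrow> table" where
  "insert_root s i w [] Z = Z"
| "insert_root s i w (g # G) Z =
     (if w < g then Z else case Z of
        [] \<Rightarrow> (s, SOne i) # insert_root s i w G []
      | z # Z' \<Rightarrow> (if s < fst z then (s, SOne i) else z) # insert_root s i w G Z')"

fun merge_pairs :: "int \<Rightarrow> int list \<Rightarrow> table list \<Rightarrow> table list" where
  "merge_pairs c G [] = []"
| "merge_pairs c G [a] = [a]"
| "merge_pairs c G (a # b # L) = merge_tables c G a G b [] # merge_pairs c G L"

lemma length_merge_pairs: "length (merge_pairs c G L) = (length L + 1) div 2"
  by (induction c G L rule: merge_pairs.induct) auto

function merge_all :: "int \<Rightarrow> int list \<Rightarrow> table list \<Rightarrow> table" where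
  "merge_all c G [] = [(0, SNil)]"
| "merge_all c G [a] = a"
| "merge_all c G (a # b # L) = merge_all c G (merge_pairs c G (a # b # L))"
  by pat_completeness auto
termination
  by (relation "measure (\<lambda>(c, G, L). length L)") (auto simp: length_merge_pairs)

text \<open>The binary logarithm rounded up, in the form in which a round of
  \<open>merge_pairs\<close> shrinks a list of \<open>d\<close> tables.\<close>

fun rounds :: "nat \<Rightarrow> nat" where
  "rounds d = (if d < 2 then 0 else 1 + rounds ((d + 1) div 2))"

declare rounds.simps [simp del]

text \<open>Not the depth of the tree but the largest number of merges on a path from the root to a
  leaf; unary nodes contribute 0.\<close>

fun height :: "'a rtree \<Rightarrow> nat" where
  "height (Node x ts) = foldr max (map height ts) 0 + rounds (length ts)"

fun total :: "(nat \<Rightarrow> int) \<Rightarrow> nat rtree \<Rightarrow> int" where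
  "total pr (Node x ts) = pr x + sum_list (map (total pr) ts)"

fun covered :: "(nat \<Rightarrow> int) \<Rightarrow> nat set \<Rightarrow> nat rtree \<Rightarrow> int" where
  "covered pr M (Node x ts) =
     (if x \<in> M then total pr (Node x ts) else sum_list (map (covered pr M) ts))"

text \<open>Members of \<open>M\<close> outside the tree are ignored, so one selection can be
  measured on every subtree without intersecting it first.\<close>

definition weight :: "(nat \<Rightarrow> int) \<Rightarrow> nat set \<Rightarrow> nat rtree \<Rightarrow> int" where
  "weight sz M t = (\<Sum>i\<leftarrow>labels t. if i \<in> M then sz i else 0)"

fun table_of :: "(nat \<Rightarrow> int) \<Rightarrow> (nat \<Rightarrow> int) \<Rightarrow> int \<Rightarrow> int list \<Rightarrow> nat rtree \<Rightarrow> table" where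
  "table_of sz pr c G (Node x ts) =
     (let Z = merge_all c G (map (table_of sz pr c G) ts) in
      if c < sz x then Z else insert_root (sz x) x (total pr (Node x ts)) G Z)"

function grid :: "nat \<Rightarrow> nat \<Rightarrow> nat \<Rightarrow> nat list" where
  "grid g m d = (if m < g then [] else g # grid (g + 1 + g div d) m d)"
  by auto
termination by (relation "measure (\<lambda>(g, m, d). m + 1 - g)") auto

declare grid.simps [simp del]

fun top_fitting :: "(nat \<Rightarrow> int) \<Rightarrow> int \<Rightarrow> nat rtree \<Rightarrow> nat list" where
  "top_fitting sz c (Node x ts) =
     (if c < sz x then (case ts of [] \<Rightarrow> [] | t # ts' \<Rightarrow> top_fitting sz c t) else [x])"

text \<open>When the sweep drops \<open>y\<close>, its sum is below the current target and hence
  below \<open>G ! k\<close>, so partner \<open>j\<close> comes later. When it keeps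
  \<open>y\<close>, the costs being sorted, \<open>y\<close> is at most as expensive as partner
  \<open>j\<close>.\<close>

lemma add_shifted_cover:
  assumes "sorted G" "sorted (map fst Y)" "length Y \<le> length H"
    and "j < length Y" "k < length G" "G ! k \<le> u + H ! j" "fst x + fst (Y ! j) \<le> c"
  shows "k < length (add_shifted c u x G H Y acc) \<and>
    fst (add_shifted c u x G H Y acc ! k) \<le> fst x + fst (Y ! j)"
  using assms
proof (induction c u x G H Y acc arbitrary: j k rule: add_shifted.induct)
  case (4 c u x g G h H y Y acc)
  note IH = "4.IH" and prems = "4.prems"
  have y: "fst y \<le> fst ((y # Y) ! j)"
    using prems(2,4) by (cases j) auto
  consider "u + h < g" | "\<not> u + h < g" "c < fst x + fst y" | "\<not> u + h < g" "\<not> c < fst x + fst y"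
    by blast
  then show ?case
  proof cases
    case 1
    have "g \<le> (g # G) ! k" using prems(1,5) by (cases k) auto
    with 1 prems(6) obtain j' where "j = Suc j'" by (cases j) auto
    with IH(1)[OF 1, of j' k] prems 1 show ?thesis by auto
  next
    case 2
    with y prems(7) show ?thesis by linarith
  next
    case 3
    show ?thesis
    proof (cases k)
      case 0
      with 3 y show ?thesis by (auto split: list.split)
    next
      case (Suc k')
      have "k' < length (add_shifted c u x G (h # H) (y # Y) (tl acc)) \<and>
        fst (add_shifted c u x G (h # H) (y # Y) (tl acc) ! k') \<le> fst x + fst ((y # Y) ! j)"
      proof (cases acc)
        case Nil
        with IH(2)[OF 3 Nil, of j k'] prems Suc show ?thesis by simp
      next
        case (Cons a acc')
        with IH(3)[OF 3 Cons, of j k'] prems Suc show ?thesis by simp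
      qed
      with 3 Suc show ?thesis by (cases acc) auto
    qed
  qed
qed auto

text \<open>An entry is replaced only by a cheaper one; what one row achieves therefore survives all
  later rows.\<close>

lemma add_shifted_mono:
  assumes "length Y \<le> length H" "k < length acc"
  shows "k < length (add_shifted c u x G H Y acc) \<and>
    fst (add_shifted c u x G H Y acc ! k) \<le> fst (acc ! k)"
  using assms
proof (induction c u x G H Y acc arbitrary: k rule: add_shifted.induct)
  case (4 c u x g G h H y Y acc)
  then show ?case
    by (cases k) (auto split: list.split)
qed auto

text \<open>Soundness of a row: an entry is inherited or is a genuine combination that reaches its
  target within the capacity.\<close>

lemma add_shifted_entry:
  assumes "k < length (add_shifted c u x G H Y acc)"
  shows "k < length acc \<and> add_shifted c u x G H Y acc ! k = acc ! k \<or>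
    k < length G \<and> (\<exists>j<length Y. j < length H \<and> G ! k \<le> u + H ! j \<and> fst x + fst (Y ! j) \<le> c \<and>
      add_shifted c u x G H Y acc ! k = (fst x + fst (Y ! j), SJoin (snd x) (snd (Y ! j))))"
  using assms
proof (induction c u x G H Y acc arbitrary: k rule: add_shifted.induct)
  case (4 c u x g G h H y Y acc)
  note IH = "4.IH" and prems = "4.prems"
  consider "u + h < g" | "\<not> u + h < g" "c < fst x + fst y" | "\<not> u + h < g" "\<not> c < fst x + fst y"
    by blast
  then show ?case
  proof cases
    case 1
    with IH(1)[OF 1, of k] prems show ?thesis by fastforce
  next
    case 2
    with prems show ?thesis by simp
  next
    case 3
    show ?thesis
    proof (cases k)
      case 0
      with 3 show ?thesis by (cases acc) (auto intro!: exI[of _ 0])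
    next
      case (Suc k')
      show ?thesis
      proof (cases acc)
        case Nil
        with IH(2)[OF 3 Nil, of k'] prems Suc 3 show ?thesis by simp
      next
        case (Cons a acc')
        with IH(3)[OF 3 Cons, of k'] prems Suc 3 show ?thesis by simp
      qed
    qed
  qed
qed auto

lemma add_shifted_bound:
  assumes "\<forall>a\<in>set acc. b \<le> fst a" "\<forall>y\<in>set Y. b \<le> fst x + fst y"
  shows "\<forall>z\<in>set (add_shifted c u x G H Y acc). b \<le> fst z"
  using assms
  by (induction c u x G H Y acc rule: add_shifted.induct) (auto split: list.split)

text \<open>Later targets get the same partner or a more expensive one, and the minimum of two
  increasing sequences increases. Sortedness has to survive because the next merge sweeps over the
  result.\<close>

lemma add_shifted_sorted:
  assumes "sorted (map fst Y)" "sorted (map fst acc)"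
  shows "sorted (map fst (add_shifted c u x G H Y acc))"
  using assms
proof (induction c u x G H Y acc rule: add_shifted.induct)
  case (4 c u x g G h H y Y acc)
  note IH = "4.IH" and prems = "4.prems"
  consider "u + h < g" | "\<not> u + h < g" "c < fst x + fst y" | "\<not> u + h < g" "\<not> c < fst x + fst y"
    by blast
  then show ?case
  proof cases
    case 1
    with IH(1)[OF 1] prems show ?thesis by simp
  next
    case 2
    with prems show ?thesis by simp
  next
    case 3
    show ?thesis
    proof (cases acc)
      case Nil
      have "\<forall>z\<in>set (add_shifted c u x G (h # H) (y # Y) []). fst x + fst y \<le> fst z"
        by (rule add_shifted_bound) (use prems in auto)
      with IH(2)[OF 3 Nil] prems 3 Nil show ?thesis by simp
    next
      case (Cons a acc')
      have "\<forall>z\<in>set (add_shifted c u x G (h # H) (y # Y) acc'). min (fst a) (fst x + fst y) \<le> fst z"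
        by (rule add_shifted_bound) (use prems Cons in \<open>auto simp: min_le_iff_disj\<close>)
      with IH(3)[OF 3 Cons] prems 3 Cons show ?thesis by (auto simp: min_def split: if_splits)
    qed
  qed
qed auto

lemma merge_tables_mono:
  assumes "length Y \<le> length G" "length X \<le> length H" "k < length acc"
  shows "k < length (merge_tables c G X H Y acc) \<and>
    fst (merge_tables c G X H Y acc ! k) \<le> fst (acc ! k)"
  using assms
proof (induction c G X H Y acc rule: merge_tables.induct)
  case (3 c G x X h H Y acc)
  then show ?case
    using add_shifted_mono[of Y G k acc c h x G] by force
qed auto

text \<open>Row \<open>i\<close> brings the entry at \<open>k\<close> down to the cost of the pair,
  and monotonicity keeps it there during the remaining rows.\<close>

lemma merge_tables_cover:
  assumes "sorted G" "sorted (map fst Y)" "length Y \<le> length G" "length X \<le> length H"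
    and "i < length X" "j < length Y" "k < length G" "G ! k \<le> H ! i + G ! j"
    and "fst (X ! i) + fst (Y ! j) \<le> c"
  shows "k < length (merge_tables c G X H Y acc) \<and>
    fst (merge_tables c G X H Y acc ! k) \<le> fst (X ! i) + fst (Y ! j)"
  using assms
proof (induction c G X H Y acc arbitrary: i rule: merge_tables.induct)
  case (3 c G x X h H Y acc)
  show ?case
  proof (cases i)
    case 0
    let ?S = "add_shifted c h x G G Y acc"
    have S: "k < length ?S \<and> fst (?S ! k) \<le> fst x + fst (Y ! j)"
      using add_shifted_cover[of G Y G j k h x c acc] 3 0 by simp
    have "k < length (merge_tables c G X H Y ?S) \<and>
        fst (merge_tables c G X H Y ?S ! k) \<le> fst (?S ! k)"
      using merge_tables_mono[of Y G X H k ?S c] 3(4,5) S by simp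
    with S 0 show ?thesis by auto
  next
    case (Suc i')
    with 3 show ?thesis by simp
  qed
qed auto

lemma merge_tables_sorted:
  assumes "length Y \<le> length G" "sorted (map fst Y)" "sorted (map fst acc)"
  shows "sorted (map fst (merge_tables c G X H Y acc))"
  using assms
  by (induction c G X H Y acc rule: merge_tables.induct) (auto simp: add_shifted_sorted)

text \<open>Starting from \<open>acc = []\<close>, the first alternative disappears and every entry
  of a merged table is a join of one entry from each side.\<close>

lemma merge_tables_entry:
  assumes "k < length (merge_tables c G X H Y acc)"
  shows "k < length acc \<and> merge_tables c G X H Y acc ! k = acc ! k \<or>
    k < length G \<and> (\<exists>i j. i < length X \<and> j < length Y \<and> i < length H \<and> j < length G \<and>
      G ! k \<le> H ! i + G ! j \<and> fst (X ! i) + fst (Y ! j) \<le> c \<and>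
      merge_tables c G X H Y acc ! k =
        (fst (X ! i) + fst (Y ! j), SJoin (snd (X ! i)) (snd (Y ! j))))"
  using assms
proof (induction c G X H Y acc rule: merge_tables.induct)
  case (3 c G x X h H Y acc)
  let ?S = "add_shifted c h x G G Y acc"
  let ?R = "merge_tables c G X H Y ?S"
  from 3 have "k < length ?S \<and> ?R ! k = ?S ! k \<or>
    k < length G \<and> (\<exists>i j. i < length X \<and> j < length Y \<and> i < length H \<and> j < length G \<and>
      G ! k \<le> H ! i + G ! j \<and> fst (X ! i) + fst (Y ! j) \<le> c \<and>
      ?R ! k = (fst (X ! i) + fst (Y ! j), SJoin (snd (X ! i)) (snd (Y ! j))))"
    by simp
  then show ?case
  proof (elim disjE conjE exE)
    assume *: "k < length ?S" "?R ! k = ?S ! k"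
    from add_shifted_entry[OF *(1)] show ?thesis
    proof (elim disjE conjE exE)
      fix j
      assume "k < length G" "j < length Y" "j < length G" "G ! k \<le> h + G ! j"
        "fst x + fst (Y ! j) \<le> c" "?S ! k = (fst x + fst (Y ! j), SJoin (snd x) (snd (Y ! j)))"
      with * show ?thesis
        by (intro disjI2 conjI exI[of _ "0::nat"] exI[of _ j]) auto
    qed (use * in simp)
  next
    fix i j
    assume "k < length G" "i < length X" "j < length Y" "i < length H" "j < length G"
      "G ! k \<le> H ! i + G ! j" "fst (X ! i) + fst (Y ! j) \<le> c"
      "?R ! k = (fst (X ! i) + fst (Y ! j), SJoin (snd (X ! i)) (snd (Y ! j)))"
    then show ?thesis
      by (intro disjI2 conjI exI[of _ "Suc i"] exI[of _ j]) auto
  qed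
qed auto

section \<open>Inserting the root of a subtree into the table of its children\<close>

lemma insert_root_mono:
  assumes "k < length Z"
  shows "k < length (insert_root s i w G Z) \<and> fst (insert_root s i w G Z ! k) \<le> fst (Z ! k)"
  using assms
proof (induction s i w G Z arbitrary: k rule: insert_root.induct)
  case (2 s i w g G Z)
  then show ?case by (cases k) (auto split: list.split)
qed auto

lemma insert_root_cover:
  assumes "sorted G" "k < length G" "G ! k \<le> w"
  shows "k < length (insert_root s i w G Z) \<and> fst (insert_root s i w G Z ! k) \<le> s"
  using assms
proof (induction s i w G Z arbitrary: k rule: insert_root.induct)
  case (2 s i w g G Z)
  have "g \<le> (g # G) ! k" using 2(3,4) by (cases k) auto
  with 2(5) have "\<not> w < g" by simp
  with 2 show ?case by (cases k) (auto split: list.split)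
qed auto

lemma insert_root_entry:
  assumes "k < length (insert_root s i w G Z)"
  shows "k < length Z \<and> insert_root s i w G Z ! k = Z ! k \<or>
    k < length G \<and> G ! k \<le> w \<and> insert_root s i w G Z ! k = (s, SOne i)"
  using assms
proof (induction s i w G Z arbitrary: k rule: insert_root.induct)
  case (2 s i w g G Z)
  then show ?case by (cases k) (auto split: list.splits if_splits)
qed auto

lemma insert_root_bound:
  assumes "b \<le> s" "\<forall>z\<in>set Z. b \<le> fst z"
  shows "\<forall>z\<in>set (insert_root s i w G Z). b \<le> fst z"
  using assms(2)
proof (induction G arbitrary: Z)
  case (Cons g G)
  show ?case
  proof (cases Z)
    case Nil
    with Cons.IH[of "[]"] assms(1) show ?thesis by simp
  next
    case (Cons z Z')
    with Cons.IH[of Z'] Cons.prems assms(1) show ?thesis by simp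
  qed
qed simp

text \<open>Each old entry becomes the minimum of its cost and \<open>s\<close>, and each new one
  costs \<open>s\<close>. The second assumption says that the insertion passes all old entries
  before it stops.\<close>

lemma insert_root_sorted:
  assumes "sorted (map fst Z)" "\<And>k. k < length Z \<Longrightarrow> k < length G \<and> G ! k \<le> w"
  shows "sorted (map fst (insert_root s i w G Z))"
  using assms
proof (induction s i w G Z rule: insert_root.induct)
  case (2 s i w g G Z)
  show ?case
  proof (cases "w < g")
    case True
    with 2(4)[of 0] have "Z = []" by (cases Z) auto
    with True show ?thesis by simp
  next
    case False
    show ?thesis
    proof (cases Z)
      case Nil
      have "\<forall>y\<in>set (insert_root s i w G []). s \<le> fst y"
        by (rule insert_root_bound) auto
      with 2(1)[OF False Nil] False Nil show ?thesis by simp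
    next
      case (Cons z Z')
      have "k < length G \<and> G ! k \<le> w" if "k < length Z'" for k
        using 2(4)[of "Suc k"] Cons that by simp
      with 2(2)[OF False Cons] 2(3) Cons have *: "sorted (map fst (insert_root s i w G Z'))"
        by simp
      have "\<forall>y\<in>set (insert_root s i w G Z'). min s (fst z) \<le> fst y"
        by (rule insert_root_bound) (use 2(3) Cons in \<open>auto simp: min_le_iff_disj\<close>)
      with * False Cons show ?thesis by (auto simp: min_def split: if_splits)
    qed
  qed
qed auto


section \<open>Accuracy of the tables\<close>

declare subtrees.simps [simp del]

abbreviation forest_labels :: "'a rtree list \<Rightarrow> 'a list" where
  "forest_labels ts \<equiv> concat (map labels ts)"

abbreviation forest_total :: "(nat \<Rightarrow> int) \<Rightarrow> nat rtree list \<Rightarrow> int" where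
  "forest_total pr ts \<equiv> sum_list (map (total pr) ts)"

abbreviation forest_covered :: "(nat \<Rightarrow> int) \<Rightarrow> nat set \<Rightarrow> nat rtree list \<Rightarrow> int" where
  "forest_covered pr M ts \<equiv> sum_list (map (covered pr M) ts)"

abbreviation forest_weight :: "(nat \<Rightarrow> int) \<Rightarrow> nat set \<Rightarrow> nat rtree list \<Rightarrow> int" where
  "forest_weight sz M ts \<equiv> sum_list (map (weight sz M) ts)"

section \<open>Totals, savings and weights of trees and forests\<close>

lemma labels_not_Nil: "labels t \<noteq> []"
  by (cases t) auto

lemma weight_Node:
  "weight sz M (Node x ts) = (if x \<in> M then sz x else 0) + forest_weight sz M ts"
proof -
  have "(\<Sum>i\<leftarrow>concat (map labels ts). if i \<in> M then sz i else 0) = forest_weight sz M ts"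
    by (induction ts) (auto simp: weight_def)
  then show ?thesis by (simp add: weight_def)
qed

lemma total_conv_sum_list: "total pr t = (\<Sum>i\<leftarrow>labels t. pr i)"
proof (induction t)
  case (Node x ts)
  then have "sum_list (map (total pr) ts) = sum_list (map pr (concat (map labels ts)))"
    by (induction ts) auto
  then show ?case by simp
qed

lemma covered_cong:
  assumes "\<And>i. i \<in> set (labels t) \<Longrightarrow> i \<in> M \<longleftrightarrow> i \<in> N"
  shows "covered pr M t = covered pr N t"
  using assms
proof (induction t)
  case (Node x ts)
  have "forest_covered pr M ts = forest_covered pr N ts"
    using Node by (intro arg_cong[where f = sum_list] map_cong) auto
  with Node.prems show ?case by simp
qed

lemma forest_covered_cong:
  assumes "\<And>i. i \<in> set (forest_labels ts) \<Longrightarrow> i \<in> M \<longleftrightarrow> i \<in> N"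
  shows "forest_covered pr M ts = forest_covered pr N ts"
  using assms by (intro arg_cong[where f = sum_list] map_cong covered_cong) auto

lemma weight_cong:
  assumes "\<And>i. i \<in> set (labels t) \<Longrightarrow> i \<in> M \<longleftrightarrow> i \<in> N"
  shows "weight sz M t = weight sz N t"
  unfolding weight_def using assms by (intro arg_cong[where f = sum_list] map_cong) auto

lemma forest_weight_cong:
  assumes "\<And>i. i \<in> set (forest_labels ts) \<Longrightarrow> i \<in> M \<longleftrightarrow> i \<in> N"
  shows "forest_weight sz M ts = forest_weight sz N ts"
  using assms by (intro arg_cong[where f = sum_list] map_cong weight_cong) auto

lemma covered_empty: "covered pr {} t = 0"
  by (induction t) (auto simp: sum_list_eq_0_iff intro!: sum_list_0 cong: map_cong)

lemma total_nonneg: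
  assumes "\<forall>i\<in>set (labels t). 0 \<le> pr i"
  shows "0 \<le> total pr t"
  unfolding total_conv_sum_list using assms by (intro sum_list_nonneg) auto

lemma forest_total_nonneg:
  assumes "\<forall>i\<in>set (forest_labels ts). 0 \<le> pr i"
  shows "0 \<le> forest_total pr ts"
  using assms by (intro sum_list_nonneg) (auto intro!: total_nonneg)

lemma covered_le_total:
  assumes "\<forall>i\<in>set (labels t). 0 \<le> pr i"
  shows "covered pr M t \<le> total pr t"
  using assms
proof (induction t)
  case (Node x ts)
  then have "forest_covered pr M ts \<le> forest_total pr ts"
    by (intro sum_list_mono) auto
  with Node.prems show ?case by simp
qed

lemma forest_covered_le_total:
  assumes "\<forall>i\<in>set (forest_labels ts). 0 \<le> pr i"
  shows "forest_covered pr M ts \<le> forest_total pr ts"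
  using assms by (intro sum_list_mono covered_le_total) auto

lemma forest_weight_nonneg:
  assumes "\<forall>i\<in>set (forest_labels ts). 0 \<le> sz i"
  shows "0 \<le> forest_weight sz M ts"
  using assms by (intro sum_list_nonneg) (auto simp: weight_def intro!: sum_list_nonneg)

text \<open>All that accuracy needs of the grid: it increases from 0, and every value up to
  \<open>P\<close> has a grid point below it within the factor \<rho>. \<open>P\<close> stands for
  the total saving, beyond which nothing is ever rounded.\<close>

locale view_table =
  fixes sz pr :: "nat \<Rightarrow> int" and c P :: int and G :: "int list" and \<rho> :: real
  assumes c_nonneg: "0 \<le> c"
    and rho: "1 \<le> \<rho>"
    and grid_sorted: "sorted G"
    and grid_Cons: "\<exists>G'. G = 0 # G'"
    and grid_dense: "\<And>v. 0 \<le> v \<Longrightarrow> v \<le> P \<Longrightarrow>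
      \<exists>k<length G. G ! k \<le> v \<and> real_of_int v \<le> \<rho> * real_of_int (G ! k)"
begin

lemma grid_nonneg: "k < length G \<Longrightarrow> 0 \<le> G ! k"
  using grid_sorted grid_Cons by (cases k) auto

text \<open>
  The table \<open>Z\<close> lists, for an initial segment of the grid \<open>G\<close>, selections in the forest \<open>ts\<close> that
  save at least the grid value. The number \<open>e\<close> counts the roundings down to the grid on the way.
\<close>

definition is_table :: "nat rtree list \<Rightarrow> nat \<Rightarrow> table \<Rightarrow> bool" where
  "is_table ts e Z \<longleftrightarrow>
     sorted (map fst Z) \<and> length Z \<le> length G \<and>
     (\<forall>k<length Z. 0 \<le> fst (Z ! k) \<and> fst (Z ! k) \<le> c \<and> sol_set (snd (Z ! k)) \<subseteq> set (forest_labels ts) \<and>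
        sol_size (snd (Z ! k)) + 1 \<le> max 2 (2 * length (forest_labels ts)) \<and>
        forest_weight sz (sol_set (snd (Z ! k))) ts \<le> fst (Z ! k) \<and>
        G ! k \<le> forest_covered pr (sol_set (snd (Z ! k))) ts) \<and>
     (\<forall>M. forest_weight sz M ts \<le> c \<longrightarrow>
        (\<exists>k<length Z. fst (Z ! k) \<le> forest_weight sz M ts \<and>
           real_of_int (forest_covered pr M ts) \<le> \<rho> ^ e * real_of_int (G ! k)))"

definition is_forest :: "nat rtree list \<Rightarrow> bool" where
  "is_forest ts \<longleftrightarrow> distinct (forest_labels ts) \<and>
     (\<forall>i\<in>set (forest_labels ts). 0 \<le> sz i \<and> 0 \<le> pr i) \<and> forest_total pr ts \<le> P"

lemma is_forest_append:
  assumes "is_forest (fs @ gs)"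
  shows "is_forest fs" "is_forest gs"
    "set (forest_labels fs) \<inter> set (forest_labels gs) = {}"
proof -
  have "0 \<le> forest_total pr fs" "0 \<le> forest_total pr gs"
    using assms by (auto simp: is_forest_def intro!: forest_total_nonneg)
  with assms show "is_forest fs" "is_forest gs"
    "set (forest_labels fs) \<inter> set (forest_labels gs) = {}"
    by (auto simp: is_forest_def)
qed

text \<open>Brings tables with different numbers of roundings to a common number: children of
  different heights, and a table left without a partner in a round.\<close>

lemma is_table_mono:
  assumes "is_table ts e Z" "e \<le> e'"
  shows "is_table ts e' Z"
  unfolding is_table_def
proof (intro conjI allI impI)
  fix M assume "forest_weight sz M ts \<le> c"
  with assms(1) obtain k where k: "k < length Z" "fst (Z ! k) \<le> forest_weight sz M ts"
    "real_of_int (forest_covered pr M ts) \<le> \<rho> ^ e * real_of_int (G ! k)"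
    unfolding is_table_def by blast
  have "k < length G" using assms(1) k(1) unfolding is_table_def by linarith
  then have "\<rho> ^ e * real_of_int (G ! k) \<le> \<rho> ^ e' * real_of_int (G ! k)"
    using grid_nonneg rho assms(2) by (intro mult_right_mono power_increasing) auto
  with k show "\<exists>k<length Z. fst (Z ! k) \<le> forest_weight sz M ts \<and>
           real_of_int (forest_covered pr M ts) \<le> \<rho> ^ e' * real_of_int (G ! k)"
    by (intro exI[of _ k]) auto
qed (use assms(1) in \<open>auto simp: is_table_def\<close>)

lemma is_table_Nil: "is_table [] e [(0, SNil)]"
  using grid_Cons c_nonneg by (auto simp: is_table_def)

text \<open>A selection splits into its parts in the two forests. Each part is matched by an entry
  up to the factor \<open>\<rho> ^ e\<close>, and rounding the sum of the two grid values down to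
  the grid adds one more \<rho>. Conversely, as the labels are disjoint, savings and weights of
  joined selections add up.\<close>

lemma is_table_merge:
  assumes X: "is_table fs e X" and Y: "is_table gs e Y" and F: "is_forest (fs @ gs)"
    and ne: "fs \<noteq> []" "gs \<noteq> []"
  shows "is_table (fs @ gs) (Suc e) (merge_tables c G X G Y [])"
proof -
  let ?R = "merge_tables c G X G Y []"
  note F1 = is_forest_append(1)[OF F] and F2 = is_forest_append(2)[OF F]
    and disj = is_forest_append(3)[OF F]
  have len: "length X \<le> length G" "length Y \<le> length G" and srt: "sorted (map fst Y)"
    using X Y by (auto simp: is_table_def)
  \<comment> \<open>With both forests nonempty the size bound is twice the number of labels, and the
    spare 1 on each side pays for the join: (2a - 1) + (2b - 1) + 1 = 2(a + b) - 1.\<close>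
  have "forest_labels fs \<noteq> []" "forest_labels gs \<noteq> []"
    using ne labels_not_Nil by (cases fs; cases gs; auto)+
  then have lab: "1 \<le> length (forest_labels fs)" "1 \<le> length (forest_labels gs)"
    by (metis One_nat_def Suc_leI length_greater_0_conv)+
  show ?thesis
    unfolding is_table_def
  proof (intro conjI)
    show "sorted (map fst ?R)"
      by (rule merge_tables_sorted) (use len srt in auto)
    show "length ?R \<le> length G"
    proof (rule ccontr)
      assume "\<not> length ?R \<le> length G"
      with merge_tables_entry[of "length G" c G X G Y "[]"] show False by auto
    qed
    show "\<forall>k<length ?R. 0 \<le> fst (?R ! k) \<and> fst (?R ! k) \<le> c \<and>
      sol_set (snd (?R ! k)) \<subseteq> set (forest_labels (fs @ gs)) \<and>
      sol_size (snd (?R ! k)) + 1 \<le> max 2 (2 * length (forest_labels (fs @ gs))) \<and>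
      forest_weight sz (sol_set (snd (?R ! k))) (fs @ gs) \<le> fst (?R ! k) \<and>
      G ! k \<le> forest_covered pr (sol_set (snd (?R ! k))) (fs @ gs)"
    proof (intro allI impI)
      fix k assume "k < length ?R"
      from merge_tables_entry[OF this] obtain i j where
        ij: "i < length X" "j < length Y" "G ! k \<le> G ! i + G ! j" "fst (X ! i) + fst (Y ! j) \<le> c"
        and R: "?R ! k = (fst (X ! i) + fst (Y ! j), SJoin (snd (X ! i)) (snd (Y ! j)))"
        by auto
      let ?A = "sol_set (snd (X ! i))" and ?B = "sol_set (snd (Y ! j))"
      have A: "0 \<le> fst (X ! i)" "?A \<subseteq> set (forest_labels fs)"
        "sol_size (snd (X ! i)) + 1 \<le> max 2 (2 * length (forest_labels fs))"
        "forest_weight sz ?A fs \<le> fst (X ! i)" "G ! i \<le> forest_covered pr ?A fs"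
        using X ij(1) unfolding is_table_def by blast+
      have B: "0 \<le> fst (Y ! j)" "?B \<subseteq> set (forest_labels gs)"
        "sol_size (snd (Y ! j)) + 1 \<le> max 2 (2 * length (forest_labels gs))"
        "forest_weight sz ?B gs \<le> fst (Y ! j)" "G ! j \<le> forest_covered pr ?B gs"
        using Y ij(2) unfolding is_table_def by blast+
      have "forest_weight sz (?A \<union> ?B) fs = forest_weight sz ?A fs"
        "forest_covered pr (?A \<union> ?B) fs = forest_covered pr ?A fs"
        using B(2) disj by (auto intro!: forest_weight_cong forest_covered_cong)
      moreover have "forest_weight sz (?A \<union> ?B) gs = forest_weight sz ?B gs"
        "forest_covered pr (?A \<union> ?B) gs = forest_covered pr ?B gs"
        using A(2) disj by (auto intro!: forest_weight_cong forest_covered_cong)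
      ultimately show "0 \<le> fst (?R ! k) \<and> fst (?R ! k) \<le> c \<and>
        sol_set (snd (?R ! k)) \<subseteq> set (forest_labels (fs @ gs)) \<and>
        sol_size (snd (?R ! k)) + 1 \<le> max 2 (2 * length (forest_labels (fs @ gs))) \<and>
        forest_weight sz (sol_set (snd (?R ! k))) (fs @ gs) \<le> fst (?R ! k) \<and>
        G ! k \<le> forest_covered pr (sol_set (snd (?R ! k))) (fs @ gs)"
        unfolding R using A B ij lab by auto
    qed
    show "\<forall>M. forest_weight sz M (fs @ gs) \<le> c \<longrightarrow>
      (\<exists>k<length ?R. fst (?R ! k) \<le> forest_weight sz M (fs @ gs) \<and>
         real_of_int (forest_covered pr M (fs @ gs)) \<le> \<rho> ^ Suc e * real_of_int (G ! k))"
    proof (intro allI impI)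
      fix M assume M: "forest_weight sz M (fs @ gs) \<le> c"
      have nn: "0 \<le> forest_weight sz M fs" "0 \<le> forest_weight sz M gs"
        using F1 F2 by (auto simp: is_forest_def intro!: forest_weight_nonneg)
      with M have "forest_weight sz M fs \<le> c" "forest_weight sz M gs \<le> c" by auto
      with X Y obtain i j where
        i: "i < length X" "fst (X ! i) \<le> forest_weight sz M fs"
          "real_of_int (forest_covered pr M fs) \<le> \<rho> ^ e * real_of_int (G ! i)" and
        j: "j < length Y" "fst (Y ! j) \<le> forest_weight sz M gs"
          "real_of_int (forest_covered pr M gs) \<le> \<rho> ^ e * real_of_int (G ! j)"
        unfolding is_table_def by meson
      \<comment> \<open>The grid rounds only values up to \<open>P\<close>. Both grid values are
        attained by actual selections, so each is at most the total of its forest, and the sum stays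
        within the total of both.\<close>
      have "G ! i \<le> forest_covered pr (sol_set (snd (X ! i))) fs"
        using X i(1) unfolding is_table_def by blast
      also have "\<dots> \<le> forest_total pr fs"
        using F1 by (intro forest_covered_le_total) (auto simp: is_forest_def)
      finally have Gi: "G ! i \<le> forest_total pr fs" .
      have "G ! j \<le> forest_covered pr (sol_set (snd (Y ! j))) gs"
        using Y j(1) unfolding is_table_def by blast
      also have "\<dots> \<le> forest_total pr gs"
        using F2 by (intro forest_covered_le_total) (auto simp: is_forest_def)
      finally have "G ! i + G ! j \<le> P"
        using Gi F by (auto simp: is_forest_def)
      moreover have "0 \<le> G ! i + G ! j"
        using grid_nonneg[of i] grid_nonneg[of j] i(1) j(1) len by auto
      ultimately obtain k where k: "k < length G" "G ! k \<le> G ! i + G ! j"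
        "real_of_int (G ! i + G ! j) \<le> \<rho> * real_of_int (G ! k)"
        using grid_dense by blast
      have "k < length ?R \<and> fst (?R ! k) \<le> fst (X ! i) + fst (Y ! j)"
        using i j k M len srt grid_sorted by (intro merge_tables_cover) auto
      moreover have "real_of_int (forest_covered pr M (fs @ gs)) \<le> \<rho> ^ e * real_of_int (G ! i + G ! j)"
        using i(3) j(3) by (simp add: algebra_simps)
      moreover have "\<rho> ^ e * real_of_int (G ! i + G ! j) \<le> \<rho> ^ e * (\<rho> * real_of_int (G ! k))"
        using rho k(3) by (intro mult_left_mono) auto
      ultimately show "\<exists>k<length ?R. fst (?R ! k) \<le> forest_weight sz M (fs @ gs) \<and>
         real_of_int (forest_covered pr M (fs @ gs)) \<le> \<rho> ^ Suc e * real_of_int (G ! k)"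
        using i j by (intro exI[of _ k]) (auto simp: mult.assoc mult.commute[of \<rho>])
    qed
  qed
qed

text \<open>\<open>F\<close> cuts the forest into consecutive blocks, one per table. A round joins
  neighbouring blocks, which leaves the concatenation unchanged; an odd last block is only weakened
  to \<open>Suc e\<close>.\<close>

lemma is_table_merge_pairs:
  assumes "list_all2 (\<lambda>fs Z. is_table fs e Z \<and> fs \<noteq> []) F Zs" "is_forest (concat F)"
  shows "\<exists>F'. list_all2 (\<lambda>fs Z. is_table fs (Suc e) Z \<and> fs \<noteq> []) F' (merge_pairs c G Zs) \<and>
    concat F' = concat F"
  using assms
proof (induction Zs arbitrary: F rule: induct_list012)
  case 1
  then show ?case by auto
next
  case (2 a)
  then obtain fs where "F = [fs]" "is_table fs e a" "fs \<noteq> []"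
    by (auto simp: list_all2_Cons2)
  then show ?case by (intro exI[of _ "[fs]"]) (auto intro: is_table_mono)
next
  case (3 a b L)
  then obtain fs gs F1 where F: "F = fs # gs # F1" "is_table fs e a" "is_table gs e b"
    "fs \<noteq> []" "gs \<noteq> []" and L: "list_all2 (\<lambda>fs Z. is_table fs e Z \<and> fs \<noteq> []) F1 L"
    by (auto simp: list_all2_Cons2)
  have *: "is_forest ((fs @ gs) @ concat F1)" using 3 F by simp
  from 3(1)[OF L is_forest_append(2)[OF *]] obtain F' where
    "list_all2 (\<lambda>fs Z. is_table fs (Suc e) Z \<and> fs \<noteq> []) F' (merge_pairs c G L)" "concat F' = concat F1"
    by auto
  with F is_table_merge[OF F(2,3) is_forest_append(1)[OF *] F(4,5)] show ?case
    by (intro exI[of _ "(fs @ gs) # F'"]) auto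
qed

lemma is_table_merge_all:
  assumes "list_all2 (\<lambda>fs Z. is_table fs e Z \<and> fs \<noteq> []) F Zs" "is_forest (concat F)"
  shows "is_table (concat F) (e + rounds (length Zs)) (merge_all c G Zs)"
  using assms
proof (induction "length Zs" arbitrary: Zs F e rule: less_induct)
  case less
  consider "Zs = []" | a where "Zs = [a]" | a b L where "Zs = a # b # L"
    by (metis list.exhaust)
  then show ?case
  proof cases
    case 1
    with less.prems show ?thesis by (simp add: is_table_Nil)
  next
    case 2
    with less.prems show ?thesis by (auto simp: list_all2_Cons2 rounds.simps)
  next
    case 3
    from is_table_merge_pairs[OF less.prems] obtain F' where
      F': "list_all2 (\<lambda>fs Z. is_table fs (Suc e) Z \<and> fs \<noteq> []) F' (merge_pairs c G Zs)"
        "concat F' = concat F"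
      by auto
    have "length (merge_pairs c G Zs) < length Zs"
      using 3 by (simp add: length_merge_pairs)
    from less.hyps[OF this F'(1)] F'(2) less.prems(2)
    have "is_table (concat F) (Suc e + rounds (length (merge_pairs c G Zs)))
      (merge_all c G (merge_pairs c G Zs))" by simp
    moreover have "rounds (length Zs) = Suc (rounds (length (merge_pairs c G Zs)))"
      using 3 by (subst rounds.simps) (simp add: length_merge_pairs)
    ultimately show ?thesis using 3 by simp
  qed
qed

text \<open>Weights are nonnegative, so a root larger than the capacity lies in no feasible
  selection.\<close>

lemma is_table_skip_root:
  assumes Z: "is_table ts e Z" and F: "is_forest [Node x ts]" and c: "c < sz x"
  shows "is_table [Node x ts] e Z"
proof -
  have x: "x \<notin> set (forest_labels ts)" and nn: "\<forall>i\<in>set (forest_labels ts). 0 \<le> sz i"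
    using F by (auto simp: is_forest_def)
  have weight: "0 \<le> forest_weight sz M ts" for M
    using nn by (rule forest_weight_nonneg)
  show ?thesis
    unfolding is_table_def
  proof (intro conjI)
    show "\<forall>k<length Z. 0 \<le> fst (Z ! k) \<and> fst (Z ! k) \<le> c \<and>
      sol_set (snd (Z ! k)) \<subseteq> set (forest_labels [Node x ts]) \<and>
      sol_size (snd (Z ! k)) + 1 \<le> max 2 (2 * length (forest_labels [Node x ts])) \<and>
      forest_weight sz (sol_set (snd (Z ! k))) [Node x ts] \<le> fst (Z ! k) \<and>
      G ! k \<le> forest_covered pr (sol_set (snd (Z ! k))) [Node x ts]"
    proof (intro allI impI)
      fix k assume "k < length Z"
      with Z have "0 \<le> fst (Z ! k)" "fst (Z ! k) \<le> c"
        "sol_set (snd (Z ! k)) \<subseteq> set (forest_labels ts)"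
        "sol_size (snd (Z ! k)) + 1 \<le> max 2 (2 * length (forest_labels ts))"
        "forest_weight sz (sol_set (snd (Z ! k))) ts \<le> fst (Z ! k)"
        "G ! k \<le> forest_covered pr (sol_set (snd (Z ! k))) ts"
        unfolding is_table_def by blast+
      with x show "0 \<le> fst (Z ! k) \<and> fst (Z ! k) \<le> c \<and>
        sol_set (snd (Z ! k)) \<subseteq> set (forest_labels [Node x ts]) \<and>
        sol_size (snd (Z ! k)) + 1 \<le> max 2 (2 * length (forest_labels [Node x ts])) \<and>
        forest_weight sz (sol_set (snd (Z ! k))) [Node x ts] \<le> fst (Z ! k) \<and>
        G ! k \<le> forest_covered pr (sol_set (snd (Z ! k))) [Node x ts]"
        by (auto simp: weight_Node)
    qed
    show "\<forall>M. forest_weight sz M [Node x ts] \<le> c \<longrightarrow>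
      (\<exists>k<length Z. fst (Z ! k) \<le> forest_weight sz M [Node x ts] \<and>
        real_of_int (forest_covered pr M [Node x ts]) \<le> \<rho> ^ e * real_of_int (G ! k))"
    proof (intro allI impI)
      fix M assume M: "forest_weight sz M [Node x ts] \<le> c"
      with weight[of M] c have "x \<notin> M" by (auto simp: weight_Node)
      with M Z show "\<exists>k<length Z. fst (Z ! k) \<le> forest_weight sz M [Node x ts] \<and>
        real_of_int (forest_covered pr M [Node x ts]) \<le> \<rho> ^ e * real_of_int (G ! k)"
        unfolding is_table_def by (simp add: weight_Node)
    qed
  qed (use Z in \<open>auto simp: is_table_def\<close>)
qed

text \<open>A selection containing the root saves exactly the total of the subtree, which is rounded
  once from scratch; hence the errors below do not accumulate with it, and \<open>1 \<le> e\<close>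
  is enough.\<close>

lemma is_table_insert_root:
  assumes Z: "is_table ts e Z" and F: "is_forest [Node x ts]" and c: "sz x \<le> c" and e: "1 \<le> e"
  shows "is_table [Node x ts] e (insert_root (sz x) x (total pr (Node x ts)) G Z)"
proof -
  let ?w = "total pr (Node x ts)"
  let ?R = "insert_root (sz x) x ?w G Z"
  have x: "x \<notin> set (forest_labels ts)" and nn: "\<forall>i\<in>set (forest_labels ts). 0 \<le> sz i"
    and pos: "0 \<le> sz x" "0 \<le> pr x" and pr: "\<forall>i\<in>set (forest_labels ts). 0 \<le> pr i"
    and wP: "?w \<le> P"
    using F by (auto simp: is_forest_def)
  have weight: "0 \<le> forest_weight sz M ts" for M
    using nn by (rule forest_weight_nonneg)
  have Zk: "0 \<le> fst (Z ! k)" "fst (Z ! k) \<le> c"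
        "sol_set (snd (Z ! k)) \<subseteq> set (forest_labels ts)"
        "sol_size (snd (Z ! k)) + 1 \<le> max 2 (2 * length (forest_labels ts))"
        "forest_weight sz (sol_set (snd (Z ! k))) ts \<le> fst (Z ! k)"
        "G ! k \<le> forest_covered pr (sol_set (snd (Z ! k))) ts" if "k < length Z" for k
    using Z that unfolding is_table_def by blast+
  have len: "length Z \<le> length G" using Z by (simp add: is_table_def)
  have Gw: "k < length G \<and> G ! k \<le> ?w" if k: "k < length Z" for k
  proof -
    have "G ! k \<le> forest_total pr ts"
      using Zk(6)[OF k] forest_covered_le_total[OF pr] by (rule order_trans)
    with pos k len show ?thesis by simp
  qed
  show ?thesis
    unfolding is_table_def
  proof (intro conjI)
    show "sorted (map fst ?R)"
      using Z Gw by (intro insert_root_sorted) (auto simp: is_table_def)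
    show "length ?R \<le> length G"
    proof (rule ccontr)
      assume "\<not> length ?R \<le> length G"
      with insert_root_entry[of "length G" "sz x" x ?w G Z] len show False by auto
    qed
    show "\<forall>k<length ?R. 0 \<le> fst (?R ! k) \<and> fst (?R ! k) \<le> c \<and>
      sol_set (snd (?R ! k)) \<subseteq> set (forest_labels [Node x ts]) \<and>
      sol_size (snd (?R ! k)) + 1 \<le> max 2 (2 * length (forest_labels [Node x ts])) \<and>
      forest_weight sz (sol_set (snd (?R ! k))) [Node x ts] \<le> fst (?R ! k) \<and>
      G ! k \<le> forest_covered pr (sol_set (snd (?R ! k))) [Node x ts]"
    proof (intro allI impI)
      fix k assume "k < length ?R"
      from insert_root_entry[OF this] show "0 \<le> fst (?R ! k) \<and> fst (?R ! k) \<le> c \<and>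
        sol_set (snd (?R ! k)) \<subseteq> set (forest_labels [Node x ts]) \<and>
        sol_size (snd (?R ! k)) + 1 \<le> max 2 (2 * length (forest_labels [Node x ts])) \<and>
        forest_weight sz (sol_set (snd (?R ! k))) [Node x ts] \<le> fst (?R ! k) \<and>
        G ! k \<le> forest_covered pr (sol_set (snd (?R ! k))) [Node x ts]"
      proof (elim disjE conjE)
        assume k: "k < length Z" "?R ! k = Z ! k"
        from Zk[OF k(1)] x show ?thesis unfolding k(2) by (auto simp: weight_Node)
      next
        assume k: "G ! k \<le> ?w" "?R ! k = (sz x, SOne x)"
        have "forest_weight sz {x} ts = forest_weight sz {} ts"
          using x by (intro forest_weight_cong) auto
        also have "\<dots> = 0" by (induction ts) (simp_all add: weight_def)
        finally show ?thesis using k pos c by (auto simp: weight_Node)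
      qed
    qed
    show "\<forall>M. forest_weight sz M [Node x ts] \<le> c \<longrightarrow>
      (\<exists>k<length ?R. fst (?R ! k) \<le> forest_weight sz M [Node x ts] \<and>
        real_of_int (forest_covered pr M [Node x ts]) \<le> \<rho> ^ e * real_of_int (G ! k))"
    proof (intro allI impI)
      fix M assume M: "forest_weight sz M [Node x ts] \<le> c"
      show "\<exists>k<length ?R. fst (?R ! k) \<le> forest_weight sz M [Node x ts] \<and>
        real_of_int (forest_covered pr M [Node x ts]) \<le> \<rho> ^ e * real_of_int (G ! k)"
      proof (cases "x \<in> M")
        case True
        have "0 \<le> ?w" using F by (intro total_nonneg) (auto simp: is_forest_def)
        with wP obtain k where k: "k < length G" "G ! k \<le> ?w" "real_of_int ?w \<le> \<rho> * real_of_int (G ! k)"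
          using grid_dense by blast
        have "\<rho> ^ 1 * real_of_int (G ! k) \<le> \<rho> ^ e * real_of_int (G ! k)"
          using rho e grid_nonneg[OF k(1)] by (intro mult_right_mono power_increasing) auto
        with True k insert_root_cover[OF grid_sorted k(1,2), of "sz x" x Z] weight[of M] show ?thesis
          by (intro exI[of _ k]) (auto simp: weight_Node)
      next
        case False
        with M Z obtain k where "k < length Z" "fst (Z ! k) \<le> forest_weight sz M ts"
          "real_of_int (forest_covered pr M ts) \<le> \<rho> ^ e * real_of_int (G ! k)"
          unfolding is_table_def by (auto simp: weight_Node)
        with False insert_root_mono[of k Z "sz x" x ?w G] show ?thesis
          by (intro exI[of _ k]) (auto simp: weight_Node)
      qed
    qed
  qed
qed

lemma height_child: "t \<in> set ts \<Longrightarrow> height t \<le> foldr max (map height ts) 0"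
  by (induction ts) auto

text \<open>The \<open>Suc\<close> accounts for the single rounding of an inserted element, the only
  one at a leaf. The child tables are weakened to the largest height among them before the merging
  rounds are counted.\<close>

lemma is_table_table_of:
  assumes "is_forest [t]"
  shows "is_table [t] (Suc (height t)) (table_of sz pr c G t)"
  using assms
proof (induction t)
  case (Node x ts)
  let ?h = "foldr max (map height ts) 0"
  have pos: "0 \<le> pr x" using Node.prems by (auto simp: is_forest_def)
  have child: "is_forest [t]" if t: "t \<in> set ts" for t
  proof -
    from t obtain as bs where ts: "ts = as @ t # bs" by (meson split_list)
    have "is_forest ts" using Node.prems pos by (auto simp: is_forest_def)
    then have "is_forest ((as @ [t]) @ bs)" by (simp add: ts)
    from is_forest_append(2)[OF is_forest_append(1)[OF this]] show ?thesis .
  qed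
  have "list_all2 (\<lambda>fs Z. is_table fs (Suc ?h) Z \<and> fs \<noteq> []) (map (\<lambda>t. [t]) ts)
    (map (table_of sz pr c G) ts)"
    unfolding list_all2_map1 list_all2_map2
    using is_table_mono[OF Node.IH[OF _ child]] height_child[of _ ts]
    by (simp add: list_all2_same)
  from is_table_merge_all[OF this] Node.prems pos
  have Z: "is_table ts (Suc ?h + rounds (length ts)) (merge_all c G (map (table_of sz pr c G) ts))"
    by (simp add: is_forest_def)
  then show ?case
    using is_table_skip_root[OF Z Node.prems] is_table_insert_root[OF Z Node.prems]
    by (simp add: Let_def)
qed

end

section \<open>The geometric grid: density and length\<close>

lemma grid_less: "v \<in> set (grid g m d) \<Longrightarrow> g \<le> v \<and> v \<le> m"
proof (induction g m d rule: grid.induct)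
  case (1 g m d)
  show ?case
  proof (cases "m < g")
    case True
    with 1(2) show ?thesis by (simp add: grid.simps)
  next
    case False
    with 1(2) have "v = g \<or> v \<in> set (grid (g + 1 + g div d) m d)"
      by (simp add: grid.simps[of g])
    with 1(1)[OF False] False show ?thesis by auto
  qed
qed

lemma sorted_grid: "sorted (grid g m d)"
proof (induction g m d rule: grid.induct)
  case (1 g m d)
  then show ?case
    using grid_less[of _ "g + 1 + g div d" m d]
    by (subst grid.simps) force
qed

text \<open>An integer before the next point is at most \<open>g + g div d\<close>, hence at most (1
  + 1/d) g. The extra 1 in the step keeps the grid moving while \<open>g < d\<close>, where every
  integer is a grid point.\<close>

lemma grid_dense:
  assumes "g \<le> v" "v \<le> m" "0 < d"
  shows "\<exists>k<length (grid g m d). grid g m d ! k \<le> v \<and>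
    real v \<le> (1 + 1 / real d) * real (grid g m d ! k)"
  using assms
proof (induction g m d rule: grid.induct)
  case (1 g m d)
  then have g: "\<not> m < g" by simp
  show ?case
  proof (cases "g + 1 + g div d \<le> v")
    case True
    from 1(1)[OF g this 1(3,4)] obtain k where "k < length (grid (g + 1 + g div d) m d)"
      "grid (g + 1 + g div d) m d ! k \<le> v"
      "real v \<le> (1 + 1 / real d) * real (grid (g + 1 + g div d) m d ! k)" by blast
    with g show ?thesis by (subst (1 2 3) grid.simps) (auto intro!: exI[of _ "Suc k"])
  next
    case False
    then have "v \<le> g + g div d" by simp
    then have "real v \<le> real g + real (g div d)" by linarith
    also have "real (g div d) \<le> real g / real d" by (rule of_nat_div_le_of_nat)
    finally have "real v \<le> (1 + 1 / real d) * real g" by (simp add: algebra_simps)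
    with g 1(2) show ?thesis by (subst (1 2 3) grid.simps) (auto intro!: exI[of _ 0])
  qed
qed

lemma grid_Cons: "grid 0 m d = 0 # grid 1 m d"
  by (subst grid.simps) simp

lemma length_grid_le: "length (grid g m d) \<le> m + 1 - g"
proof (induction g m d rule: grid.induct)
  case (1 g m d)
  then show ?case by (subst grid.simps) force
qed

text \<open>It is \<open>g + 1\<close> that grows by the factor 1 + 1/d in each step: despite the
  integer division, (g + 1)/d is at most \<open>g div d + 1\<close>. The shift also takes care of
  the start at 0.\<close>

lemma length_grid_power:
  assumes "0 < d" "g \<le> m"
  shows "(1 + 1 / real d) ^ (length (grid g m d) - 1) * (real g + 1) \<le> real m + 1"
  using assms
proof (induction g m d rule: grid.induct)
  case (1 g m d)
  then have g: "\<not> m < g" by simp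
  let ?g = "g + 1 + g div d"
  have step: "(1 + 1 / real d) * (real g + 1) \<le> real ?g + 1"
  proof -
    have "real g = real d * real (g div d) + real (g mod d)"
      by (metis of_nat_add of_nat_mult mult_div_mod_eq)
    moreover have "real (g mod d) \<le> real d - 1"
      using 1(2) by (metis One_nat_def Suc_leI mod_less_divisor of_nat_1 of_nat_Suc of_nat_le_iff add.commute le_diff_eq)
    ultimately have "real g + 1 \<le> real d * (real (g div d) + 1)" by (simp add: algebra_simps)
    then have "(real g + 1) / real d \<le> real (g div d) + 1"
      using 1(2) by (simp add: divide_le_eq mult.commute)
    then show ?thesis by (simp add: algebra_simps add_divide_distrib)
  qed
  show ?case
  proof (cases "m < ?g")
    case True
    then have "grid ?g m d = []" by (subst grid.simps) simp
    with g have "grid g m d = [g]" by (subst grid.simps) simp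
    with g show ?thesis by simp
  next
    case False
    let ?L = "length (grid ?g m d)"
    have "0 < ?L" using False by (subst grid.simps) simp
    moreover have "length (grid g m d) = Suc ?L" using g by (subst grid.simps) simp
    ultimately have "(1 + 1 / real d) ^ (length (grid g m d) - 1) * (real g + 1)
      = (1 + 1 / real d) ^ (?L - 1) * ((1 + 1 / real d) * (real g + 1))"
      by (cases ?L) (auto simp: algebra_simps)
    also have "\<dots> \<le> (1 + 1 / real d) ^ (?L - 1) * (real ?g + 1)"
      using step by (intro mult_left_mono) auto
    also have "\<dots> \<le> real m + 1"
      using 1(1)[OF g 1(2)] False by simp
    finally show ?thesis .
  qed
qed

text \<open>By Bernoulli, (1 + 1/d)^d is at least 2, so d steps at least double
  \<open>g + 1\<close>.\<close>

lemma length_grid_log: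
  assumes "0 < d"
  shows "real (length (grid 0 m d)) \<le> 1 + real d * log 2 (real m + 1)"
proof -
  let ?K = "length (grid 0 m d) - 1"
  have "2 \<le> (1 + 1 / real d) ^ d"
    using Bernoulli_inequality[of "1 / real d" d] assms order_trans[of "-1" 0 "1 / real d"] by simp
  then have "2 ^ ?K \<le> ((1 + 1 / real d) ^ d) ^ ?K" by (intro power_mono) auto
  also have "\<dots> = ((1 + 1 / real d) ^ ?K) ^ d" by (simp add: power_mult[symmetric] mult.commute)
  also have "\<dots> \<le> (real m + 1) ^ d"
    using length_grid_power[OF assms, of 0 m] by (intro power_mono) auto
  finally have "log 2 (2 ^ ?K) \<le> log 2 ((real m + 1) ^ d)" by (subst log_le_cancel_iff) auto
  then have "real ?K \<le> real d * log 2 (real m + 1)" by (simp add: log_nat_power)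
  moreover have "length (grid 0 m d) = Suc ?K" by (simp add: grid_Cons)
  ultimately show ?thesis by simp
qed


section \<open>Ancestors, savings and the degree product\<close>

lemma weight_conv_sum:
  assumes "distinct (labels t)" "M \<subseteq> set (labels t)"
  shows "weight sz M t = sum sz M"
proof -
  have "weight sz M t = (\<Sum>i\<in>set (labels t). if i \<in> M then sz i else 0)"
    unfolding weight_def using assms(1) by (rule sum_list_distinct_conv_sum_set)
  also have "\<dots> = sum sz (set (labels t) \<inter> M)" by (simp add: sum.inter_restrict)
  also have "set (labels t) \<inter> M = M" using assms(2) by auto
  finally show ?thesis .
qed

text \<open>\<open>AD\<close> is a transitive closure; this description of it by recursion on the
  tree makes structural induction possible.\<close>

fun ancestor :: "'a rtree \<Rightarrow> ('a \<times> 'a) set" where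
  "ancestor (Node x ts) = {x} \<times> set (forest_labels ts) \<union> (\<Union>t\<in>set ts. ancestor t)"

lemma ancestor_subset: "ancestor t \<subseteq> set (labels t) \<times> set (labels t)"
  by (induction t) fastforce

lemma root_in_labels: "root_label t \<in> set (labels t)"
  by (cases t) simp

lemma ancestor_root: "y \<in> set (labels t) \<Longrightarrow> y = root_label t \<or> (root_label t, y) \<in> ancestor t"
  by (cases t) auto

lemma parent_child_Node:
  "parent_child (Node x ts) =
     {(x, root_label t) | t. t \<in> set ts} \<union> (\<Union>t\<in>set ts. parent_child t)"
  unfolding parent_child_def by (auto simp: subtrees.simps)

lemma distinct_forestD:
  assumes "distinct (forest_labels ts)" "t \<in> set ts" "u \<in> set ts"
    and "y \<in> set (labels t)" "y \<in> set (labels u)"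
  shows "t = u"
  using assms by (induction ts) auto

text \<open>Labels being distinct, the middle element belongs to only one child subtree, so two
  composable pairs below the root lie in the same one.\<close>

lemma trans_ancestor: "distinct (labels t) \<Longrightarrow> trans (ancestor t)"
proof (induction t)
  case (Node x ts)
  show ?case
  proof (rule transI)
    fix a b d
    assume ab: "(a, b) \<in> ancestor (Node x ts)" and bd: "(b, d) \<in> ancestor (Node x ts)"
    have b: "b \<in> set (forest_labels ts)"
      using ab ancestor_subset by fastforce
    with Node.prems have "b \<noteq> x" by auto
    with bd obtain u where u: "u \<in> set ts" "(b, d) \<in> ancestor u" by auto
    then have ud: "b \<in> set (labels u)" "d \<in> set (labels u)" using ancestor_subset by fastforce+
    show "(a, d) \<in> ancestor (Node x ts)"
    proof (cases "a = x")
      case True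
      with ud u show ?thesis by auto
    next
      case False
      with ab obtain t where t: "t \<in> set ts" "(a, b) \<in> ancestor t" by auto
      then have "b \<in> set (labels t)" using ancestor_subset by fastforce
      with distinct_forestD[of ts t u b] Node.prems t u ud have "t = u" by simp
      moreover have "trans (ancestor u)"
        using Node u(1) by (auto simp: distinct_concat_iff)
      ultimately have "(a, d) \<in> ancestor u" using t u by (auto dest: transD)
      with u show ?thesis by auto
    qed
  qed
qed

lemma AD_eq_ancestor:
  assumes "distinct (labels t)"
  shows "AD t = ancestor t"
proof
  have "parent_child t \<subseteq> ancestor t"
  proof (induction t)
    case (Node x ts)
    then show ?case using root_in_labels by (fastforce simp: parent_child_Node)
  qed
  then have "(parent_child t)\<^sup>+ \<subseteq> (ancestor t)\<^sup>+" by (rule trancl_mono_subset)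
  also have "\<dots> = ancestor t" using trans_ancestor[OF assms] by (rule trancl_id)
  finally show "AD t \<subseteq> ancestor t" by (simp add: AD_def)
  show "ancestor t \<subseteq> AD t"
  proof (induction t)
    case (Node x ts)
    have sub: "AD t \<subseteq> AD (Node x ts)" if "t \<in> set ts" for t
      unfolding AD_def using that by (intro trancl_mono_subset) (auto simp: parent_child_Node)
    show ?case
    proof
      fix e assume "e \<in> ancestor (Node x ts)"
      then consider t y where "t \<in> set ts" "e = (x, y)" "y \<in> set (labels t)"
        | t where "t \<in> set ts" "e \<in> ancestor t" by auto
      then show "e \<in> AD (Node x ts)"
      proof cases
        case 1
        have root: "(x, root_label t) \<in> AD (Node x ts)"
          unfolding AD_def using 1(1) by (intro r_into_trancl) (auto simp: parent_child_Node)
        from ancestor_root[OF 1(3)] show ?thesis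
        proof
          assume "(root_label t, y) \<in> ancestor t"
          with Node.IH[OF 1(1)] sub[OF 1(1)] have "(root_label t, y) \<in> AD (Node x ts)" by blast
          with root 1(2) show ?thesis unfolding AD_def by auto
        qed (use root 1 in simp)
      next
        case 2
        with Node.IH[OF 2(1)] sub[OF 2(1)] show ?thesis by blast
      qed
    qed
  qed
qed

lemma sum_UN_forest:
  assumes "distinct (forest_labels ts)" "\<And>t. t \<in> set ts \<Longrightarrow> S t \<subseteq> set (labels t)"
  shows "sum pr (\<Union>t\<in>set ts. S t) = (\<Sum>t\<leftarrow>ts. sum pr (S t))"
  using assms
proof (induction ts)
  case (Cons t ts)
  have "(\<Union>u\<in>set ts. S u) \<subseteq> set (forest_labels ts)" "S t \<subseteq> set (labels t)"
    using Cons.prems(2) by auto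
  then have "S t \<inter> (\<Union>u\<in>set ts. S u) = {}"
    using Cons.prems(1) by auto
  moreover have "finite (S t)" "finite (\<Union>u\<in>set ts. S u)"
    using Cons.prems(2) by (auto intro: finite_subset[OF _ finite_set])
  ultimately show ?case
    using Cons by (simp add: sum.union_disjoint)
qed simp

text \<open>The set is the closure of \<open>M\<close> within the tree. If the root is selected, the
  closure is the whole tree; otherwise it splits into the disjoint closures in the children. This is
  the bridge from \<open>saving\<close> to the recursive \<open>covered\<close>.\<close>

lemma sum_closure_eq_covered:
  assumes "distinct (labels t)"
  shows "sum pr (M \<inter> set (labels t) \<union> ancestor t `` M) = covered pr M t"
  using assms
proof (induction t)
  case (Node x ts)
  show ?case
  proof (cases "x \<in> M")
    case True
    have "M \<inter> set (labels (Node x ts)) \<union> ancestor (Node x ts) `` M = set (labels (Node x ts))"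
      using True ancestor_subset[of "Node x ts"] by auto
    then show ?thesis
      using True Node.prems
      by (simp add: total_conv_sum_list[of pr "Node x ts", unfolded sum_list_distinct_conv_sum_set[OF Node.prems]]
          del: labels.simps total.simps)
  next
    case False
    have "M \<inter> set (labels (Node x ts)) \<union> ancestor (Node x ts) `` M =
      (\<Union>t\<in>set ts. M \<inter> set (labels t) \<union> ancestor t `` M)"
      using False by auto
    also have "sum pr \<dots> = (\<Sum>t\<leftarrow>ts. sum pr (M \<inter> set (labels t) \<union> ancestor t `` M))"
    proof (rule sum_UN_forest)
      show "distinct (forest_labels ts)" using Node.prems by simp
      show "M \<inter> set (labels t) \<union> ancestor t `` M \<subseteq> set (labels t)" for t
        using ancestor_subset[of t] by auto
    qed
    also have "\<dots> = forest_covered pr M ts"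
      using Node by (intro arg_cong[where f = sum_list] map_cong) (auto simp: distinct_concat_iff)
    finally show ?thesis using False by simp
  qed
qed

definition profit :: "view_instance \<Rightarrow> nat \<Rightarrow> int" where
  "profit I i = freq I i * (cost_R I i - cost_A I i)"

lemma saving_eq_covered:
  assumes "valid_instance I" "M \<subseteq> elems I"
  shows "saving I M = covered (profit I) M (ad_tree I)"
proof -
  have d: "distinct (labels (ad_tree I))" and M: "M \<inter> set (labels (ad_tree I)) = M"
    using assms by (auto simp: valid_instance_def)
  show ?thesis
    using sum_closure_eq_covered[OF d, of "profit I" M]
    by (simp add: saving_def plus_closure_def AD_eq_ancestor[OF d] M profit_def)
qed

lemma feasible_iff_weight:
  assumes "valid_instance I"
  shows "feasible I M \<longleftrightarrow> M \<subseteq> elems I \<and> weight (elem_size I) M (ad_tree I) \<le> capacity I"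
  using assms weight_conv_sum[of "ad_tree I" M "elem_size I"]
  by (auto simp: feasible_def valid_instance_def)

lemma opt_saving_attained:
  assumes "valid_instance I"
  obtains M where "feasible I M" "saving I M = opt_saving I"
proof -
  have "finite {M. feasible I M}"
    by (rule finite_subset[of _ "Pow (elems I)"]) (auto simp: feasible_def elems_def)
  moreover have "feasible I {}"
    using assms by (simp add: feasible_def valid_instance_def)
  ultimately have "opt_saving I \<in> saving I ` {M. feasible I M}"
    unfolding opt_saving_def by (intro Max_in) auto
  then show thesis using that by auto
qed

text \<open>Halving gives 2((d + 1)/2)^2 = (d + 1)^2 / 2, which is at most d^2 from d = 3 on; d = 2
  is checked directly. The square reflects that a logarithm rounded up is at most twice the
  logarithm.\<close>

lemma two_power_rounds_le: "1 \<le> d \<Longrightarrow> 2 ^ rounds d \<le> d\<^sup>2"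
proof (induction d rule: rounds.induct)
  case (1 d)
  show ?case
  proof (cases "d < 2")
    case True
    with 1(2) show ?thesis by (subst rounds.simps) simp
  next
    case False
    let ?h = "(d + 1) div 2"
    have "2 ^ rounds d = 2 * 2 ^ rounds ?h" using False by (subst rounds.simps) simp
    also have "\<dots> \<le> 2 * ?h\<^sup>2" using 1(1)[OF False] False by simp
    also have "\<dots> \<le> d\<^sup>2"
    proof (cases "d = 2")
      case False
      with \<open>\<not> d < 2\<close> have "3 \<le> d" by simp
      have "2 * (2 * ?h\<^sup>2) = (2 * ?h)\<^sup>2" by (simp add: power2_eq_square)
      also have "\<dots> \<le> (d + 1)\<^sup>2" by (intro power_mono) auto
      also have "\<dots> \<le> 2 * d\<^sup>2"
      proof -
        have "3 * d \<le> d * d" using \<open>3 \<le> d\<close> by (intro mult_right_mono) auto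
        moreover have "(d + 1)\<^sup>2 = d * d + 2 * d + 1" by (simp add: power2_eq_square)
        ultimately show ?thesis using \<open>3 \<le> d\<close> unfolding power2_eq_square[of d] by linarith
      qed
      finally show ?thesis by simp
    qed simp
    finally show ?thesis .
  qed
qed

lemma foldr_max_attained: "xs \<noteq> [] \<Longrightarrow> foldr max xs (0::nat) \<in> set xs"
proof (induction xs)
  case (Cons x xs)
  then show ?case by (cases "xs = []") (auto simp: max_def)
qed simp

text \<open>Follow at each node a child of maximal height: the rounds along this path add up while
  the degrees multiply.\<close>

lemma height_path:
  "\<exists>ds\<in>set (path_degrees t). (2::nat) ^ height t \<le> (prod_list ds)\<^sup>2"
proof (induction t)
  case (Node x ts)
  show ?case
  proof (cases "ts = []")
    case True
    then show ?thesis by (simp add: rounds.simps)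
  next
    case False
    then have "foldr max (map height ts) 0 \<in> height ` set ts"
      using foldr_max_attained[of "map height ts"] by simp
    then obtain t where t: "t \<in> set ts" "foldr max (map height ts) 0 = height t" by auto
    with Node obtain ds where ds: "ds \<in> set (path_degrees t)" "(2::nat) ^ height t \<le> (prod_list ds)\<^sup>2" by auto
    have "(2::nat) ^ height (Node x ts) = 2 ^ height t * 2 ^ rounds (length ts)"
      by (simp add: t power_add)
    also have "\<dots> \<le> (prod_list ds)\<^sup>2 * (length ts)\<^sup>2"
      using ds two_power_rounds_le[of "length ts"] False by (intro mult_mono) (auto simp: Suc_le_eq)
    finally have "2 ^ height (Node x ts) \<le> (prod_list (length ts # ds))\<^sup>2"
      by (simp add: power_mult_distrib mult.commute)
    moreover have "length ts # ds \<in> set (path_degrees (Node x ts))"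
      using False t(1) ds(1) by auto
    ultimately show ?thesis by blast
  qed
qed

lemma two_power_height_le_chi: "(2::nat) ^ height t \<le> (chi t)\<^sup>2"
proof -
  obtain ds where ds: "ds \<in> set (path_degrees t)" "(2::nat) ^ height t \<le> (prod_list ds)\<^sup>2"
    using height_path by blast
  have "prod_list ds \<le> chi t"
    unfolding chi_def using ds(1) by (intro Max_ge) auto
  then have "(prod_list ds)\<^sup>2 \<le> (chi t)\<^sup>2" by (intro power_mono) auto
  with ds(2) show ?thesis by (rule le_trans)
qed

text \<open>Height 0 means at most one child everywhere. Elements above the first fitting one occur
  in no feasible selection, and that element alone covers all the rest.\<close>

lemma top_fitting_optimal:
  assumes "height t = 0" "distinct (labels t)" "\<forall>i\<in>set (labels t). 0 \<le> sz i \<and> 0 \<le> pr i" "0 \<le> c"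
  shows "set (top_fitting sz c t) \<subseteq> set (labels t) \<and> weight sz (set (top_fitting sz c t)) t \<le> c \<and>
    (\<forall>M. weight sz M t \<le> c \<longrightarrow> covered pr M t \<le> covered pr (set (top_fitting sz c t)) t)"
  using assms
proof (induction t)
  case (Node x ts)
  have nn: "0 \<le> forest_weight sz M ts" for M
    using Node.prems by (intro forest_weight_nonneg) auto
  show ?case
  proof (cases "c < sz x")
    case False
    have "forest_weight sz {x} ts = forest_weight sz {} ts"
      using Node.prems(2) by (intro forest_weight_cong) auto
    also have "\<dots> = 0" by (induction ts) (simp_all add: weight_def)
    finally show ?thesis
      using False covered_le_total[OF ballI, of "Node x ts" pr] Node.prems(3)
      by (auto simp: weight_Node)
  next
    case True
    have xM: "x \<notin> M" if "weight sz M (Node x ts) \<le> c" for M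
      using that True nn[of M] by (auto simp: weight_Node)
    have "length ts < 2"
      using Node.prems(1) rounds.simps[of "length ts"] by (auto split: if_splits)
    then consider "ts = []" | t where "ts = [t]"
      by (cases ts; cases "tl ts") auto
    then show ?thesis
    proof cases
      case 1
      then show ?thesis using True xM Node.prems(4) by (auto simp: weight_Node)
    next
      case 2
      have IH: "set (top_fitting sz c t) \<subseteq> set (labels t) \<and> weight sz (set (top_fitting sz c t)) t \<le> c \<and>
        (\<forall>M. weight sz M t \<le> c \<longrightarrow> covered pr M t \<le> covered pr (set (top_fitting sz c t)) t)"
        using Node.prems 2 by (intro Node.IH) auto
      then have "x \<notin> set (top_fitting sz c t)"
        using Node.prems(2) 2 by auto
      then have "covered pr (set (top_fitting sz c (Node x ts))) (Node x ts) =
          covered pr (set (top_fitting sz c t)) t"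
        "weight sz (set (top_fitting sz c (Node x ts))) (Node x ts) = weight sz (set (top_fitting sz c t)) t"
        using 2 True by (auto simp: weight_Node)
      moreover have "covered pr M (Node x ts) = covered pr M t" "weight sz M t \<le> c"
        if "weight sz M (Node x ts) \<le> c" for M
        using xM[OF that] that 2 by (auto simp: weight_Node)
      ultimately show ?thesis using IH 2 True by auto
    qed
  qed
qed


section \<open>The program and its running time\<close>

text \<open>The integer at the front distinguishes joins from single elements: element indices start
  at 1, so 0 is free to mark a join. This is why \<open>0 \<notin> sol_set s\<close> is required
  later.\<close>

fun sol_val :: "sol \<Rightarrow> val" where
  "sol_val SNil = NilV"
| "sol_val (SOne i) = ConsV (IntV (int i)) NilV"
| "sol_val (SJoin a b) = ConsV (IntV 0) (ConsV (sol_val a) (sol_val b))"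

definition table_val :: "table \<Rightarrow> val" where
  "table_val Z = list_val (map (\<lambda>z. ConsV (IntV (fst z)) (sol_val (snd z))) Z)"

lemma table_val_simps [simp]:
  "table_val [] = NilV"
  "table_val (z # Z) = ConsV (ConsV (IntV (fst z)) (sol_val (snd z))) (table_val Z)"
  by (simp_all add: table_val_def)

definition ints_val :: "int list \<Rightarrow> val" where
  "ints_val G = list_val (map IntV G)"

lemma ints_val_simps [simp]:
  "ints_val [] = NilV"
  "ints_val (g # G) = ConsV (IntV g) (ints_val G)"
  by (simp_all add: ints_val_def)

text \<open>
  Binds the cost on reconstruction and access, the frequency, the size, the index and the children
  of a tree node to the variables 2, 0, 4, 6, 8 and 11; the old variable \<open>i\<close> becomes \<open>12 + i\<close>.
\<close>

definition open_node :: "expr \<Rightarrow> expr \<Rightarrow> expr" where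
  "open_node e b =
     CaseList e NilE (CaseList (Var 0) NilE (CaseList (Var 1) NilE
       (CaseList (Var 1) NilE (CaseList (Var 1) NilE (CaseList (Var 1) NilE b)))))"

definition node_profit :: expr where
  "node_profit = Arith Mul (Var 4) (Arith Sub (Var 2) (Var 0))"

definition total_body :: expr where
  "total_body = open_node (Var 0) (Arith Add node_profit (Call 2 [Var 11]))"

definition totals_body :: expr where
  "totals_body = CaseList (Var 0) (Lit 0) (Arith Add (Call 1 [Var 0]) (Call 2 [Var 1]))"

definition height_body :: expr where
  "height_body = CaseList (Var 0) NilE
     (Arith Add (Call 4 [Var 1]) (Call 6 [Call 5 [Var 1]]))"

definition max_height_body :: expr where
  "max_height_body = CaseList (Var 0) (Lit 0)
     (LetE (Call 3 [Var 0]) (LetE (Call 4 [Var 2]) (IfLess (Var 0) (Var 1) (Var 1) (Var 0))))"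

definition length_body :: expr where
  "length_body = CaseList (Var 0) (Lit 0) (Arith Add (Lit 1) (Call 5 [Var 1]))"

definition rounds_body :: expr where
  "rounds_body = IfLess (Var 0) (Lit 2) (Lit 0)
     (Arith Add (Lit 1) (Call 6 [Arith Div (Arith Add (Var 0) (Lit 1)) (Lit 2)]))"

definition grid_body :: expr where
  "grid_body = IfLess (Var 1) (Var 0) NilE
     (ConsE (Var 0) (Call 7
       [Arith Add (Arith Add (Var 0) (Lit 1)) (Arith Div (Var 0) (Var 2)), Var 1, Var 2]))"

text \<open>The arguments are \<open>u\<close>, cost and selection of \<open>x\<close>,
  \<open>G\<close>, \<open>H\<close>, \<open>Y\<close>, \<open>acc\<close>, \<open>c\<close>, in
  this order from variable 0; each inspected cell shifts them by two and each let by one.\<close>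

definition add_shifted_body :: expr where
  "add_shifted_body = CaseList (Var 3) (Var 6) (CaseList (Var 7) (Var 8) (CaseList (Var 8) NilE
     (IfLess (Arith Add (Var 6) (Var 0)) (Var 4)
       (Call 8 [Var 6, Var 7, Var 8, Var 9, Var 1, Var 3, Var 12, Var 13])
       (CaseList (Var 2) NilE (LetE (Arith Add (Var 9) (Var 0))
         (IfLess (Var 16) (Var 0) (Var 15)
           (CaseList (Var 15)
             (ConsE (ConsE (Var 0) (ConsE (Lit 0) (ConsE (Var 11) (Var 2))))
               (Call 8 [Var 9, Var 10, Var 11, Var 8, Var 13, Var 14, NilE, Var 16]))
             (CaseList (Var 0) NilE
               (ConsE
                 (IfLess (Var 4) (Var 0)
                   (ConsE (Var 4) (ConsE (Lit 0) (ConsE (Var 15) (Var 6)))) (Var 2))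
                 (Call 8 [Var 13, Var 14, Var 15, Var 12, Var 17, Var 18, Var 3, Var 20]))))))))))"

definition merge_tables_body :: expr where
  "merge_tables_body = CaseList (Var 0) (Var 4) (CaseList (Var 3) NilE (CaseList (Var 2) NilE
     (Call 9 [Var 5, Var 3, Var 8, Var 9,
       Call 8 [Var 2, Var 0, Var 1, Var 8, Var 8, Var 9, Var 10, Var 11], Var 11])))"

definition insert_root_body :: expr where
  "insert_root_body = CaseList (Var 3) (Var 4) (IfLess (Var 4) (Var 0) (Var 6)
     (CaseList (Var 6)
       (ConsE (ConsE (Var 2) (ConsE (Var 3) NilE)) (Call 10 [Var 2, Var 3, Var 4, Var 1, NilE]))
       (CaseList (Var 0) NilE
         (ConsE (IfLess (Var 6) (Var 0) (ConsE (Var 6) (ConsE (Var 7) NilE)) (Var 2))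
           (Call 10 [Var 6, Var 7, Var 8, Var 5, Var 3])))))"

definition merge_pairs_body :: expr where
  "merge_pairs_body = CaseList (Var 0) NilE (CaseList (Var 1) (Var 2)
     (ConsE (Call 9 [Var 2, Var 5, Var 5, Var 0, NilE, Var 6]) (Call 11 [Var 1, Var 5, Var 6])))"

definition merge_all_body :: expr where
  "merge_all_body = CaseList (Var 0) (ConsE (ConsE (Lit 0) NilE) NilE) (CaseList (Var 1) (Var 0)
     (Call 12 [Call 11 [Var 4, Var 5, Var 6], Var 5, Var 6]))"

text \<open>Returns the total of the subtree along with its table. Recomputing the total at every
  node would be quadratic on a long chain.\<close>

definition solve_body :: expr where
  "solve_body = open_node (Var 0) (LetE (Call 14 [Var 11, Var 13, Var 14]) (CaseList (Var 0) NilE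
     (LetE (Arith Add (Arith Mul (Var 7) (Arith Sub (Var 5) (Var 3))) (Var 0))
       (LetE (Call 12 [Var 2, Var 17, Var 18])
         (ConsE (Var 1) (IfLess (Var 19) (Var 11) (Var 0)
           (Call 10 [Var 11, Var 13, Var 1, Var 18, Var 0])))))))"

definition solve_list_body :: expr where
  "solve_list_body = CaseList (Var 0) (ConsE (Lit 0) NilE)
     (CaseList (Call 13 [Var 0, Var 3, Var 4]) NilE (CaseList (Call 14 [Var 3, Var 5, Var 6]) NilE
       (ConsE (Arith Add (Var 2) (Var 0)) (ConsE (Var 3) (Var 1)))))"

definition last_sol_body :: expr where
  "last_sol_body = CaseList (Var 0) NilE (CaseList (Var 1) (CaseList (Var 0) NilE (Var 1))
     (Call 15 [Var 3]))"

definition sol_list_body :: expr where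
  "sol_list_body = CaseList (Var 0) (Var 1) (IfLess (Var 0) (Lit 1)
     (CaseList (Var 1) NilE (Call 16 [Var 0, Call 16 [Var 1, Var 5]]))
     (ConsE (Var 0) (Var 3)))"

definition top_fitting_body :: expr where
  "top_fitting_body = open_node (Var 0) (IfLess (Var 13) (Var 6)
     (CaseList (Var 11) NilE (Call 17 [Var 0, Var 15])) (ConsE (Var 8) NilE))"

definition main_body :: expr where
  "main_body = LetE (Call 3 [Var 0]) (IfLess (Var 0) (Lit 1) (Call 17 [Var 1, Var 2])
     (LetE (Call 7 [Lit 0, Call 1 [Var 1], Arith Add (Lit 1)
         (Arith Div (Arith Mul (Arith Mul (Lit 2) (Arith Add (Var 0) (Lit 1))) (Var 4)) (Var 3))])
       (CaseList (Call 13 [Var 2, Var 0, Var 3]) NilE (Call 16 [Call 15 [Var 1], NilE]))))"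

definition program :: prog where
  "program = [main_body, total_body, totals_body, height_body, max_height_body, length_body,
     rounds_body, grid_body, add_shifted_body, merge_tables_body, insert_root_body,
     merge_pairs_body, merge_all_body, solve_body, solve_list_body, last_sol_body,
     sol_list_body, top_fitting_body]"

lemma length_program: "length program = 18"
  by (simp add: program_def)

lemma program_nth:
  "program ! 0 = main_body" "program ! Suc 0 = total_body" "program ! 2 = totals_body"
  "program ! 3 = height_body" "program ! 4 = max_height_body" "program ! 5 = length_body"
  "program ! 6 = rounds_body" "program ! 7 = grid_body" "program ! 8 = add_shifted_body"
  "program ! 9 = merge_tables_body" "program ! 10 = insert_root_body"
  "program ! 11 = merge_pairs_body" "program ! 12 = merge_all_body" "program ! 13 = solve_body"
  "program ! 14 = solve_list_body" "program ! 15 = last_sol_body" "program ! 16 = sol_list_body"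
  "program ! 17 = top_fitting_body"
  by (simp_all add: program_def)

section \<open>Symbolic evaluation with step counts\<close>

definition wp :: "int \<Rightarrow> val list \<Rightarrow> expr \<Rightarrow> (val \<Rightarrow> nat \<Rightarrow> bool) \<Rightarrow> bool" where
  "wp W env e Q \<longleftrightarrow> (\<exists>v t. eval W program env e v t \<and> Q v t)"

definition wps :: "int \<Rightarrow> val list \<Rightarrow> expr list \<Rightarrow> (val list \<Rightarrow> nat \<Rightarrow> bool) \<Rightarrow> bool" where
  "wps W env es Q \<longleftrightarrow> (\<exists>vs t. evals W program env es vs t \<and> Q vs t)"

definition runs :: "int \<Rightarrow> nat \<Rightarrow> val list \<Rightarrow> val \<Rightarrow> nat \<Rightarrow> bool" where
  "runs W f us v t \<longleftrightarrow> f < length program \<and> eval W program us (program ! f) v t"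

text \<open>
  Not unfolded below: symbolic execution of a body by the simplifier stops at the calls, whose
  results are supplied by \<open>computesE\<close>.
\<close>

definition call :: "int \<Rightarrow> nat \<Rightarrow> val list \<Rightarrow> (val \<Rightarrow> nat \<Rightarrow> bool) \<Rightarrow> bool" where
  "call W f us Q \<longleftrightarrow> (\<exists>v t. runs W f us v t \<and> Q v t)"

definition computes :: "int \<Rightarrow> nat \<Rightarrow> val list \<Rightarrow> val \<Rightarrow> nat \<Rightarrow> bool" where
  "computes W f us v T \<longleftrightarrow> (\<exists>t\<le>T. runs W f us v t)"

lemma wp_Var: "wp W env (Var i) Q \<longleftrightarrow> i < length env \<and> Q (env ! i) 1"
  unfolding wp_def by (subst eval.simps) auto

lemma wp_Lit: "wp W env (Lit c) Q \<longleftrightarrow> \<bar>c\<bar> \<le> W \<and> Q (IntV c) 1"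
  unfolding wp_def by (subst eval.simps) auto

lemma wp_NilE: "wp W env NilE Q \<longleftrightarrow> Q NilV 1"
  unfolding wp_def by (subst eval.simps) auto

lemma wp_ConsE:
  "wp W env (ConsE a b) Q \<longleftrightarrow> wp W env a (\<lambda>u s. wp W env b (\<lambda>v t. Q (ConsV u v) (s + t + 1)))"
  unfolding wp_def by (fastforce elim!: eval_ConsEE intro: eval_evals.intros)

lemma wp_Arith:
  "wp W env (Arith f a b) Q \<longleftrightarrow> wp W env a (\<lambda>u s. wp W env b (\<lambda>v t.
     \<exists>x y. u = IntV x \<and> v = IntV y \<and> \<bar>arith f x y\<bar> \<le> W \<and> Q (IntV (arith f x y)) (s + t + 1)))"
  unfolding wp_def by (fastforce elim!: eval_ArithE intro: eval_evals.intros)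

lemma wp_IfLess:
  "wp W env (IfLess a b c d) Q \<longleftrightarrow> wp W env a (\<lambda>u s. wp W env b (\<lambda>v t.
     \<exists>x y. u = IntV x \<and> v = IntV y \<and>
       (if x < y then wp W env c (\<lambda>v r. Q v (s + t + r + 1))
        else wp W env d (\<lambda>v r. Q v (s + t + r + 1)))))"
proof -
  have "wp W env (IfLess a b c d) Q \<longleftrightarrow> (\<exists>x s y t. eval W program env a (IntV x) s \<and>
    eval W program env b (IntV y) t \<and>
    (\<exists>v r. (if x < y then eval W program env c v r else eval W program env d v r) \<and>
      Q v (s + t + r + 1)))"
    unfolding wp_def
    by (fastforce elim!: eval_IfLessE intro: eval_evals.intros split: if_splits)
  then show ?thesis unfolding wp_def by (fastforce split: if_splits)
qed

lemma wp_CaseList: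
  "wp W env (CaseList a b c) Q \<longleftrightarrow> wp W env a (\<lambda>u s. case u of
     IntV _ \<Rightarrow> False
   | NilV \<Rightarrow> wp W env b (\<lambda>v t. Q v (s + t + 1))
   | ConsV x y \<Rightarrow> wp W (x # y # env) c (\<lambda>v t. Q v (s + t + 1)))"
  unfolding wp_def
  by (fastforce elim!: eval_CaseListE intro: eval_evals.intros split: val.splits)

lemma wp_LetE:
  "wp W env (LetE a b) Q \<longleftrightarrow> wp W env a (\<lambda>u s. wp W (u # env) b (\<lambda>v t. Q v (s + t + 1)))"
  unfolding wp_def by (fastforce elim!: eval_LetEE intro: eval_evals.intros)

lemma wp_Call:
  "wp W env (Call f as) Q \<longleftrightarrow> wps W env as (\<lambda>us s. call W f us (\<lambda>v t. Q v (s + t + 1)))"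
  unfolding wp_def wps_def call_def runs_def by (fastforce elim!: eval_CallE intro: eval_evals.intros)

lemma wps_Nil: "wps W env [] Q \<longleftrightarrow> Q [] 0"
  unfolding wps_def by (subst evals.simps) auto

lemma wps_Cons:
  "wps W env (a # as) Q \<longleftrightarrow> wp W env a (\<lambda>u s. wps W env as (\<lambda>us t. Q (u # us) (s + t)))"
  unfolding wp_def wps_def by (fastforce elim!: evals_ConsE intro: eval_evals.intros)

lemmas wp_simps = wp_Var wp_Lit wp_NilE wp_ConsE wp_Arith wp_IfLess wp_CaseList wp_LetE wp_Call
  wps_Nil wps_Cons

text \<open>Determinism turns one known run into an equation valid for every postcondition, which
  the simplifier can use wherever the call occurs.\<close>

lemma call_runs: "runs W f us v t \<Longrightarrow> call W f us Q \<longleftrightarrow> Q v t"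
  unfolding call_def runs_def using eval_deterministic(1) by blast

lemma computesI:
  assumes "f < 18" "wp W us (program ! f) (\<lambda>v' t. v' = v \<and> t \<le> T)"
  shows "computes W f us v T"
  using assms by (auto simp: computes_def runs_def wp_def length_program)

lemma computesE:
  assumes "computes W f us v T"
  obtains t where "t \<le> T" "\<And>Q. call W f us Q \<longleftrightarrow> Q v t"
  using assms call_runs unfolding computes_def by metis

lemma computes_mono: "computes W f us v T \<Longrightarrow> T \<le> T' \<Longrightarrow> computes W f us v T'"
  unfolding computes_def by (meson le_trans)

text \<open>Every recursive call consumes an element of \<open>G\<close> or of \<open>Y\<close>, so
  the sweep is linear in their joint length. The bounds on sums keep the two additions of a step
  within a word.\<close>

lemma computes_add_shifted:
  assumes "0 \<le> W" "length Y \<le> length H" "\<forall>h\<in>set H. \<bar>u + h\<bar> \<le> W" "\<forall>y\<in>set Y. \<bar>fst x + fst y\<bar> \<le> W"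
  shows "computes W 8 [IntV u, IntV (fst x), sol_val (snd x), ints_val G, ints_val H, table_val Y,
      table_val acc, IntV c] (table_val (add_shifted c u x G H Y acc))
    (60 * (length G + length Y) + 20)"
  using assms
proof (induction c u x G H Y acc rule: add_shifted.induct)
  case (1 c u x H Y acc)
  show ?case by (rule computesI) (simp_all add: program_nth add_shifted_body_def wp_simps)
next
  case (2 c u x g G H acc)
  show ?case by (rule computesI) (simp_all add: program_nth add_shifted_body_def wp_simps)
next
  case (3 c u x g G y Y acc)
  then show ?case by simp
next
  case (4 c u x g G h H y Y acc)
  note IH = "4.IH" and prems = "4.prems"
  consider "u + h < g" | "\<not> u + h < g" "c < fst x + fst y" | "\<not> u + h < g" "\<not> c < fst x + fst y"
    by blast
  then show ?case
  proof cases
    case 1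
    from IH(1)[OF 1] prems obtain t where "t \<le> 60 * (length (g # G) + length Y) + 20"
      "\<And>Q. call W 8 [IntV u, IntV (fst x), sol_val (snd x), ints_val (g # G), ints_val H, table_val Y,
        table_val acc, IntV c] Q \<longleftrightarrow> Q (table_val (add_shifted c u x (g # G) H Y acc)) t"
      by (auto elim: computesE)
    with 1 prems show ?thesis
      by (intro computesI) (simp_all add: program_nth add_shifted_body_def wp_simps)
  next
    case 2
    with prems show ?thesis
      by (intro computesI) (simp_all add: program_nth add_shifted_body_def wp_simps)
  next
    case 3
    \<comment> \<open>Taking \<open>tl acc\<close>, which is empty for empty \<open>acc\<close>,
      treats both shapes of the accumulator at once.\<close>
    have "computes W 8 [IntV u, IntV (fst x), sol_val (snd x), ints_val G, ints_val (h # H),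
      table_val (y # Y), table_val (tl acc), IntV c] (table_val (add_shifted c u x G (h # H) (y # Y) (tl acc)))
      (60 * (length G + length (y # Y)) + 20)"
    proof (cases acc)
      case Nil
      with IH(2)[OF 3 Nil] prems show ?thesis by simp
    next
      case (Cons a acc')
      with IH(3)[OF 3 Cons] prems show ?thesis by simp
    qed
    then obtain t where "t \<le> 60 * (length G + length (y # Y)) + 20"
      "\<And>Q. call W 8 [IntV u, IntV (fst x), sol_val (snd x), ints_val G, ints_val (h # H),
        table_val (y # Y), table_val (tl acc), IntV c] Q \<longleftrightarrow>
        Q (table_val (add_shifted c u x G (h # H) (y # Y) (tl acc))) t"
      by (auto elim: computesE)
    with 3 prems show ?thesis
      by (cases acc; intro computesI) (simp_all add: program_nth add_shifted_body_def wp_simps)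
  qed
qed

lemma computes_merge_tables:
  assumes "0 \<le> W" "length Y \<le> length G" "length X \<le> length H"
    and "\<forall>h\<in>set H. \<forall>g\<in>set G. \<bar>h + g\<bar> \<le> W" "\<forall>x\<in>set X. \<forall>y\<in>set Y. \<bar>fst x + fst y\<bar> \<le> W"
  shows "computes W 9 [table_val X, ints_val H, ints_val G, table_val Y, table_val acc, IntV c]
    (table_val (merge_tables c G X H Y acc)) (length X * (120 * length G + 60) + 20)"
  using assms
proof (induction c G X H Y acc rule: merge_tables.induct)
  case (1 c G H Y acc)
  show ?case by (rule computesI) (simp_all add: program_nth merge_tables_body_def wp_simps)
next
  case (2 c G x X Y acc)
  then show ?case by simp
next
  case (3 c G x X h H Y acc)
  have "computes W 8 [IntV h, IntV (fst x), sol_val (snd x), ints_val G, ints_val G, table_val Y,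
      table_val acc, IntV c] (table_val (add_shifted c h x G G Y acc))
    (60 * (length G + length Y) + 20)"
    using 3 by (intro computes_add_shifted) auto
  then obtain t where t: "t \<le> 60 * (length G + length Y) + 20"
    "\<And>Q. call W 8 [IntV h, IntV (fst x), sol_val (snd x), ints_val G, ints_val G, table_val Y,
      table_val acc, IntV c] Q \<longleftrightarrow> Q (table_val (add_shifted c h x G G Y acc)) t"
    by (auto elim: computesE)
  from 3 obtain t' where t': "t' \<le> length X * (120 * length G + 60) + 20"
    "\<And>Q. call W 9 [table_val X, ints_val H, ints_val G, table_val Y,
      table_val (add_shifted c h x G G Y acc), IntV c] Q \<longleftrightarrow>
      Q (table_val (merge_tables c G X H Y (add_shifted c h x G G Y acc))) t'"
    by (auto elim: computesE)
  from t t' 3(3) show ?case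
    by (intro computesI) (simp_all add: program_nth merge_tables_body_def wp_simps)
qed

lemma computes_insert_root:
  "computes W 10 [IntV s, IntV (int i), IntV w, ints_val G, table_val Z]
    (table_val (insert_root s i w G Z)) (40 * length G + 10)"
proof (induction s i w G Z rule: insert_root.induct)
  case (1 s i w Z)
  show ?case by (rule computesI) (simp_all add: program_nth insert_root_body_def wp_simps)
next
  case (2 s i w g G Z)
  show ?case
  proof (cases "w < g")
    case True
    then show ?thesis
      by (intro computesI) (simp_all add: program_nth insert_root_body_def wp_simps)
  next
    case False
    have "computes W 10 [IntV s, IntV (int i), IntV w, ints_val G, table_val (tl Z)]
      (table_val (insert_root s i w G (tl Z))) (40 * length G + 10)"
      using 2(1)[OF False] 2(2)[OF False] by (cases Z) auto
    then obtain t where "t \<le> 40 * length G + 10"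
      "\<And>Q. call W 10 [IntV s, IntV (int i), IntV w, ints_val G, table_val (tl Z)] Q \<longleftrightarrow>
        Q (table_val (insert_root s i w G (tl Z))) t"
      by (auto elim: computesE)
    with False show ?thesis
      by (cases Z; intro computesI) (simp_all add: program_nth insert_root_body_def wp_simps)
  qed
qed

text \<open>The part of the table invariant on which the running time depends: a length within the
  grid, and costs whose pairwise sums fit in a word.\<close>

definition bounded_table :: "int \<Rightarrow> int list \<Rightarrow> table \<Rightarrow> bool" where
  "bounded_table c G Z \<longleftrightarrow> length Z \<le> length G \<and> (\<forall>z\<in>set Z. 0 \<le> fst z \<and> fst z \<le> c)"

lemma bounded_merge_tables:
  assumes "bounded_table c G X" "bounded_table c G Y"
  shows "bounded_table c G (merge_tables c G X H Y [])"
proof -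
  let ?R = "merge_tables c G X H Y []"
  have *: "k < length G \<and> 0 \<le> fst (?R ! k) \<and> fst (?R ! k) \<le> c" if k: "k < length ?R" for k
  proof -
    from merge_tables_entry[OF k] obtain i j where "k < length G" "i < length X" "j < length Y"
      "fst (X ! i) + fst (Y ! j) \<le> c" "fst (?R ! k) = fst (X ! i) + fst (Y ! j)" by auto
    with assms show ?thesis by (auto simp: bounded_table_def)
  qed
  have "length ?R \<le> length G" using *[of "length G"] by force
  with * show ?thesis by (simp add: bounded_table_def all_set_conv_all_nth)
qed

lemma bounded_merge_pairs:
  assumes "\<forall>Z\<in>set L. bounded_table c G Z"
  shows "\<forall>Z\<in>set (merge_pairs c G L). bounded_table c G Z"
  using assms by (induction L rule: induct_list012) (auto intro: bounded_merge_tables)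

lemma bounded_merge_all:
  assumes "\<forall>Z\<in>set L. bounded_table c G Z" "G \<noteq> []" "0 \<le> c"
  shows "bounded_table c G (merge_all c G L)"
  using assms
proof (induction c G L rule: merge_all.induct)
  case (1 c G)
  then show ?case by (auto simp: bounded_table_def Suc_le_eq)
next
  case (3 c G a b L)
  show ?case using 3(1)[OF bounded_merge_pairs[OF 3(2)] 3(3,4)] by simp
qed auto

lemma bounded_insert_root:
  assumes "bounded_table c G Z" "0 \<le> s" "s \<le> c"
  shows "bounded_table c G (insert_root s i w G Z)"
proof -
  let ?R = "insert_root s i w G Z"
  have *: "k < length G \<and> 0 \<le> fst (?R ! k) \<and> fst (?R ! k) \<le> c" if k: "k < length ?R" for k
    using insert_root_entry[OF k] assms by (auto simp: bounded_table_def)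
  have "length ?R \<le> length G" using *[of "length G"] by force
  with * show ?thesis by (simp add: bounded_table_def all_set_conv_all_nth)
qed

lemma bounded_table_of:
  assumes "\<forall>i\<in>set (labels t). 0 \<le> sz i" "G \<noteq> []" "0 \<le> c"
  shows "bounded_table c G (table_of sz pr c G t)"
  using assms
proof (induction t)
  case (Node x ts)
  then have "bounded_table c G (merge_all c G (map (table_of sz pr c G) ts))"
    by (intro bounded_merge_all) auto
  with Node.prems show ?case by (auto simp: Let_def intro!: bounded_insert_root)
qed

abbreviation tables_val :: "table list \<Rightarrow> val" where
  "tables_val L \<equiv> list_val (map table_val L)"

abbreviation merge_cost :: "int list \<Rightarrow> nat" where
  "merge_cost G \<equiv> length G * (120 * length G + 60) + 20"

lemma computes_merge_bounded:
  assumes "0 \<le> W" "c + c \<le> W" "\<forall>g\<in>set G. \<forall>h\<in>set G. \<bar>g + h\<bar> \<le> W"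
    and "bounded_table c G X" "bounded_table c G Y"
  shows "computes W 9 [table_val X, ints_val G, ints_val G, table_val Y, NilV, IntV c]
    (table_val (merge_tables c G X G Y [])) (merge_cost G)"
proof -
  have "\<bar>fst x + fst y\<bar> \<le> W" if "x \<in> set X" "y \<in> set Y" for x y
    using assms(2,4,5) that by (fastforce simp: bounded_table_def)
  then have "computes W 9 [table_val X, ints_val G, ints_val G, table_val Y, table_val [], IntV c]
    (table_val (merge_tables c G X G Y [])) (length X * (120 * length G + 60) + 20)"
    using assms by (intro computes_merge_tables) (auto simp: bounded_table_def)
  moreover have "length X * (120 * length G + 60) + 20 \<le> merge_cost G"
    using assms(4) by (auto simp: bounded_table_def)
  ultimately show ?thesis by (auto intro: computes_mono)
qed

lemma computes_merge_pairs:
  assumes "0 \<le> W" "c + c \<le> W" "\<forall>g\<in>set G. \<forall>h\<in>set G. \<bar>g + h\<bar> \<le> W"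
    and "\<forall>Z\<in>set L. bounded_table c G Z"
  shows "computes W 11 [tables_val L, ints_val G, IntV c] (tables_val (merge_pairs c G L))
    ((length L div 2) * (merge_cost G + 60) + 20)"
  using assms(4)
proof (induction L rule: induct_list012)
  case 1
  show ?case by (rule computesI) (simp_all add: program_nth merge_pairs_body_def wp_simps)
next
  case (2 a)
  show ?case by (rule computesI) (simp_all add: program_nth merge_pairs_body_def wp_simps)
next
  case (3 a b L)
  from 3 obtain t where t: "t \<le> (length L div 2) * (merge_cost G + 60) + 20"
    "\<And>Q. call W 11 [tables_val L, ints_val G, IntV c] Q \<longleftrightarrow> Q (tables_val (merge_pairs c G L)) t"
    by (auto elim: computesE)
  have "computes W 9 [table_val a, ints_val G, ints_val G, table_val b, NilV, IntV c]
    (table_val (merge_tables c G a G b [])) (merge_cost G)"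
    using 3 assms by (intro computes_merge_bounded) auto
  then obtain t' where t': "t' \<le> merge_cost G"
    "\<And>Q. call W 9 [table_val a, ints_val G, ints_val G, table_val b, NilV, IntV c] Q \<longleftrightarrow>
      Q (table_val (merge_tables c G a G b [])) t'"
    by (auto elim: computesE)
  from t t' show ?case
    by (intro computesI) (simp_all add: program_nth merge_pairs_body_def wp_simps)
qed

text \<open>Every merge reduces the number of tables by one, so all rounds together make fewer
  merges than there are tables; the rounds cost no logarithmic factor.\<close>

lemma computes_merge_all:
  assumes "0 \<le> W" "c + c \<le> W" "\<forall>g\<in>set G. \<forall>h\<in>set G. \<bar>g + h\<bar> \<le> W"
    and "\<forall>Z\<in>set L. bounded_table c G Z"
  shows "computes W 12 [tables_val L, ints_val G, IntV c] (table_val (merge_all c G L))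
    (length L * (merge_cost G + 120) + 20)"
  using assms(4)
proof (induction "length L" arbitrary: L rule: less_induct)
  case less
  consider "L = []" | a where "L = [a]" | a b L' where "L = a # b # L'"
    by (metis list.exhaust)
  then show ?case
  proof cases
    case 1
    with assms(1) show ?thesis
      by (intro computesI) (simp_all add: program_nth merge_all_body_def wp_simps)
  next
    case 2
    then show ?thesis
      by (intro computesI) (simp_all add: program_nth merge_all_body_def wp_simps)
  next
    case 3
    define m n where "m = length L div 2" and "n = length L - m"
    have mn: "length L = m + n" "1 \<le> m" and len: "length (merge_pairs c G L) = n"
      using 3 by (auto simp: m_def n_def length_merge_pairs)
    define B where "B = merge_cost G"
    obtain t where t: "t \<le> m * (B + 60) + 20"
      "\<And>Q. call W 11 [tables_val L, ints_val G, IntV c] Q \<longleftrightarrow> Q (tables_val (merge_pairs c G L)) t"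
      using computes_merge_pairs[OF assms(1-3) less.prems] unfolding m_def B_def
      by (auto elim: computesE)
    have "computes W 12 [tables_val (merge_pairs c G L), ints_val G, IntV c]
      (table_val (merge_all c G (merge_pairs c G L))) (n * (B + 120) + 20)"
      using less.hyps[of "merge_pairs c G L"] len mn bounded_merge_pairs[OF less.prems]
      unfolding B_def by simp
    then obtain t' where t': "t' \<le> n * (B + 120) + 20"
      "\<And>Q. call W 12 [tables_val (merge_pairs c G L), ints_val G, IntV c] Q \<longleftrightarrow>
        Q (table_val (merge_all c G (merge_pairs c G L))) t'"
      by (auto elim: computesE)
    \<comment> \<open>The \<open>m \<ge> 1\<close> merges of this round were charged 60 less than
      the budget allows, and this covers the constant overhead of the round.\<close>
    have "t + t' + 40 \<le> length L * (B + 120) + 20"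
      using t(1) t'(1) mn by (simp add: algebra_simps)
    with t(2) t'(2) 3 show ?thesis
      unfolding B_def
      by (intro computesI) (simp_all add: program_nth merge_all_body_def wp_simps)
  qed
qed

abbreviation forest_val :: "view_instance \<Rightarrow> nat rtree list \<Rightarrow> val" where
  "forest_val I ts \<equiv> list_val (map (tree_val I) ts)"

lemma length_labels_pos: "1 \<le> length (labels t)"
  by (cases t) simp

text \<open>Profits are nonnegative and their sum fits in a word, hence so does every partial sum
  formed by the traversal.\<close>

definition fits_word :: "int \<Rightarrow> view_instance \<Rightarrow> nat rtree list \<Rightarrow> bool" where
  "fits_word W I ts \<longleftrightarrow> 0 \<le> W \<and>
     (\<forall>i\<in>set (forest_labels ts). 0 \<le> profit I i \<and> \<bar>cost_R I i - cost_A I i\<bar> \<le> W) \<and>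
     forest_total (profit I) ts \<le> W"

lemma fits_word_Nil: "fits_word W I [] \<Longrightarrow> 0 \<le> W"
  by (simp add: fits_word_def)

lemma fits_word_Cons:
  assumes "fits_word W I (t # ts)"
  shows "fits_word W I [t]" "fits_word W I ts"
    "\<bar>total (profit I) t + forest_total (profit I) ts\<bar> \<le> W" "0 \<le> W"
proof -
  have "0 \<le> total (profit I) t" "0 \<le> forest_total (profit I) ts"
    using assms by (auto simp: fits_word_def intro!: total_nonneg forest_total_nonneg)
  with assms show "fits_word W I [t]" "fits_word W I ts"
    "\<bar>total (profit I) t + forest_total (profit I) ts\<bar> \<le> W" "0 \<le> W"
    by (auto simp: fits_word_def)
qed

lemma fits_word_Node:
  assumes "fits_word W I [Node x ts]"
  shows "fits_word W I ts" "\<bar>cost_R I x - cost_A I x\<bar> \<le> W" "\<bar>profit I x\<bar> \<le> W"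
    "\<bar>profit I x + forest_total (profit I) ts\<bar> \<le> W"
proof -
  have "0 \<le> forest_total (profit I) ts" "0 \<le> profit I x"
    using assms by (auto simp: fits_word_def intro!: forest_total_nonneg)
  with assms show "fits_word W I ts" "\<bar>cost_R I x - cost_A I x\<bar> \<le> W" "\<bar>profit I x\<bar> \<le> W"
    "\<bar>profit I x + forest_total (profit I) ts\<bar> \<le> W"
    by (auto simp: fits_word_def)
qed

text \<open>The claim for single trees is a premise, to be discharged by the induction hypothesis of
  the mutually recursive function. The 20 subtracted there pays for the list step around each
  tree.\<close>

lemma computes_totals:
  assumes "\<And>t. t \<in> set ts \<Longrightarrow> fits_word W I [t] \<Longrightarrow>
      computes W 1 [tree_val I t] (IntV (total (profit I) t)) (80 * length (labels t) - 20)"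
    and "fits_word W I ts"
  shows "computes W 2 [forest_val I ts] (IntV (forest_total (profit I) ts))
    (80 * length (forest_labels ts) + 5)"
  using assms
proof (induction ts)
  case Nil
  then show ?case
    by (intro computesI) (simp_all add: program_nth totals_body_def wp_simps fits_word_Nil)
next
  case (Cons t ts)
  note fits = fits_word_Cons[OF Cons.prems(2)]
  from Cons.prems(1)[of t] fits obtain r where r: "r \<le> 80 * length (labels t) - 20"
    "\<And>Q. call W 1 [tree_val I t] Q \<longleftrightarrow> Q (IntV (total (profit I) t)) r"
    by (auto elim: computesE)
  from Cons fits obtain r' where r': "r' \<le> 80 * length (forest_labels ts) + 5"
    "\<And>Q. call W 2 [forest_val I ts] Q \<longleftrightarrow> Q (IntV (forest_total (profit I) ts)) r'"
    by (auto elim: computesE)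
  have "r + r' + 20 \<le> 80 * length (forest_labels (t # ts)) + 5"
    using r(1) r'(1) length_labels_pos[of t] by simp
  with r(2) r'(2) fits show ?case
    by (intro computesI) (simp_all add: program_nth totals_body_def wp_simps)
qed

lemma computes_total:
  assumes "fits_word W I [t]"
  shows "computes W 1 [tree_val I t] (IntV (total (profit I) t)) (80 * length (labels t) - 20)"
  using assms
proof (induction t)
  case (Node x ts)
  note fits = fits_word_Node[OF Node.prems]
  obtain r where r: "r \<le> 80 * length (forest_labels ts) + 5"
    "\<And>Q. call W 2 [forest_val I ts] Q \<longleftrightarrow> Q (IntV (forest_total (profit I) ts)) r"
    using computes_totals[OF Node.IH fits(1)] by (auto elim: computesE)
  then show ?case
    using fits(2-4)
    by (intro computesI) (simp_all add: program_nth total_body_def open_node_def node_profit_def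
        wp_simps profit_def[symmetric])
qed

lemma computes_length:
  assumes "int (length vs) \<le> W" "1 \<le> W"
  shows "computes W 5 [list_val vs] (IntV (int (length vs))) (10 * length vs + 5)"
  using assms
proof (induction vs)
  case Nil
  then show ?case by (intro computesI) (simp_all add: program_nth length_body_def wp_simps)
next
  case (Cons v vs)
  then obtain t where "t \<le> 10 * length vs + 5"
    "\<And>Q. call W 5 [list_val vs] Q \<longleftrightarrow> Q (IntV (int (length vs))) t"
    by (auto elim: computesE)
  with Cons.prems show ?case
    by (intro computesI) (simp_all add: program_nth length_body_def wp_simps)
qed

lemma rounds_le: "rounds d \<le> d"
proof (induction d rule: rounds.induct)
  case (1 d)
  then show ?case by (cases "d < 2") (subst rounds.simps; simp)+
qed

lemma computes_rounds:
  assumes "int d + 1 \<le> W" "2 \<le> W"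
  shows "computes W 6 [IntV (int d)] (IntV (int (rounds d))) (30 * d + 10)"
  using assms
proof (induction d rule: rounds.induct)
  case (1 d)
  show ?case
  proof (cases "d < 2")
    case True
    then have "rounds d = 0" by (subst rounds.simps) simp
    with True 1 show ?thesis
      by (intro computesI) (simp_all add: program_nth rounds_body_def wp_simps)
  next
    case False
    let ?h = "(d + 1) div 2"
    have h: "int ?h = (int d + 1) div 2" by (simp add: zdiv_int)
    have R: "rounds d = 1 + rounds ?h" using False by (subst rounds.simps) simp
    have "?h \<le> d" using False by linarith
    then have "int ?h + 1 \<le> W" using 1(2) by linarith
    from 1(1)[OF False this 1(3)] obtain t where t: "t \<le> 30 * ?h + 10"
      "\<And>Q. call W 6 [IntV (int ?h)] Q \<longleftrightarrow> Q (IntV (int (rounds ?h))) t"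
      by (auto elim!: computesE)
    have "2 * ?h \<le> d + 1" by simp
    then have "t + 15 \<le> 30 * d + 10" using t(1) False by linarith
    moreover have "\<bar>(int d + 1) div 2\<bar> \<le> W" "\<bar>1 + int (rounds ?h)\<bar> \<le> W"
      using 1(2) rounds_le[of d] R by auto
    ultimately show ?thesis
      using t(2)[unfolded h] False 1 R
      by (intro computesI) (simp_all add: program_nth rounds_body_def wp_simps)
  qed
qed

lemma length_forest_le: "length ts \<le> length (forest_labels ts)"
proof (induction ts)
  case (Cons t ts)
  with length_labels_pos[of t] show ?case by simp
qed simp

lemma length_child_le:
  assumes "t \<in> set ts"
  shows "length (labels t) + length ts \<le> length (forest_labels ts) + 1"
  using assms
proof (induction ts)
  case (Cons u ts)
  then show ?case
    using length_labels_pos[of u] length_forest_le[of ts] by auto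
qed simp

lemma height_le: "height t \<le> 2 * length (labels t)"
proof (induction t)
  case (Node x ts)
  show ?case
  proof (cases "ts = []")
    case False
    then have "foldr max (map height ts) 0 \<in> height ` set ts"
      using foldr_max_attained[of "map height ts"] by simp
    then obtain t where "t \<in> set ts" "foldr max (map height ts) 0 = height t" by auto
    with Node.IH[of t] length_child_le[of t ts] rounds_le[of "length ts"] show ?thesis
      by simp
  qed (simp add: rounds.simps)
qed

text \<open>The 40 per child left over is what the parent then spends on its degree: 10 for the
  length of the child list and 30 for \<open>rounds\<close>.\<close>

lemma computes_max_height:
  assumes "\<And>t. t \<in> set ts \<Longrightarrow> computes W 3 [tree_val I t] (IntV (int (height t))) (150 * length (labels t) - 60)"
    and "0 \<le> W"
  shows "computes W 4 [forest_val I ts] (IntV (int (foldr max (map height ts) 0)))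
    (150 * length (forest_labels ts) + 10 - 40 * length ts)"
  using assms
proof (induction ts)
  case Nil
  then show ?case
    by (intro computesI) (simp_all add: program_nth max_height_body_def wp_simps)
next
  case (Cons t ts)
  from Cons.prems(1)[of t] obtain r where r: "r \<le> 150 * length (labels t) - 60"
    "\<And>Q. call W 3 [tree_val I t] Q \<longleftrightarrow> Q (IntV (int (height t))) r"
    by (auto elim: computesE)
  from Cons obtain r' where r': "r' \<le> 150 * length (forest_labels ts) + 10 - 40 * length ts"
    "\<And>Q. call W 4 [forest_val I ts] Q \<longleftrightarrow> Q (IntV (int (foldr max (map height ts) 0))) r'"
    by (auto elim: computesE)
  have "r + r' + 20 \<le> 150 * length (forest_labels (t # ts)) + 10 - 40 * length (t # ts)"
    using r(1) r'(1) length_labels_pos[of t] length_forest_le[of ts] by simp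
  with r(2) r'(2) show ?case
    by (intro computesI) (simp_all add: program_nth max_height_body_def wp_simps
        max_def[of "height t" "foldr max _ 0"])
qed

lemma computes_height:
  assumes "2 * int (length (labels t)) \<le> W"
  shows "computes W 3 [tree_val I t] (IntV (int (height t))) (150 * length (labels t) - 60)"
  using assms
proof (induction t)
  case (Node x ts)
  have len: "int (length ts) + 1 \<le> W" "2 \<le> W" "int (length ts) \<le> W" "1 \<le> W"
    using Node.prems length_forest_le[of ts] by auto
  have h: "int (height (Node x ts)) \<le> W" using height_le[of "Node x ts"] Node.prems by linarith
  have IH: "computes W 3 [tree_val I t] (IntV (int (height t))) (150 * length (labels t) - 60)"
    if t: "t \<in> set ts" for t
  proof (rule Node.IH[OF t])
    have "length (labels t) \<le> length (labels (Node x ts))"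
      using length_child_le[OF t] t by (cases ts) auto
    with Node.prems show "2 * int (length (labels t)) \<le> W" by linarith
  qed
  obtain r1 where r1: "r1 \<le> 150 * length (forest_labels ts) + 10 - 40 * length ts"
    "\<And>Q. call W 4 [forest_val I ts] Q \<longleftrightarrow> Q (IntV (int (foldr max (map height ts) 0))) r1"
    using computes_max_height[where ts = ts and I = I and W = W, OF IH] len by (auto elim: computesE)
  obtain r2 where r2: "r2 \<le> 10 * length ts + 5"
    "\<And>Q. call W 5 [forest_val I ts] Q \<longleftrightarrow> Q (IntV (int (length ts))) r2"
    using computes_length[of "map (tree_val I) ts" W] len by (auto elim: computesE)
  obtain r3 where r3: "r3 \<le> 30 * length ts + 10"
    "\<And>Q. call W 6 [IntV (int (length ts))] Q \<longleftrightarrow> Q (IntV (int (rounds (length ts)))) r3"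
    using computes_rounds[of "length ts" W] len by (auto elim: computesE)
  have "r1 + r2 + r3 + 20 \<le> 150 * length (labels (Node x ts)) - 60"
    using r1(1) r2(1) r3(1) length_forest_le[of ts] by simp
  with r1(2) r2(2) r3(2) h show ?case
    by (intro computesI) (simp_all add: program_nth height_body_def wp_simps)
qed

text \<open>The final call overshoots \<open>m\<close>, but from a point \<open>g \<le> m\<close>
  the next argument is at most \<open>2 * g + 1\<close>; this fixes the word size required.\<close>

lemma computes_grid:
  assumes "2 * int m + 1 \<le> W" "int g \<le> 2 * int m + 1"
  shows "computes W 7 [IntV (int g), IntV (int m), IntV (int d)] (ints_val (map int (grid g m d)))
    (30 * length (grid g m d) + 10)"
  using assms
proof (induction g m d rule: grid.induct)
  case (1 g m d)
  show ?case
  proof (cases "m < g")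
    case True
    then have "grid g m d = []" by (subst grid.simps) simp
    with True show ?thesis
      by (intro computesI) (simp_all add: program_nth grid_body_def wp_simps)
  next
    case False
    let ?g = "g + 1 + g div d"
    have g: "int ?g = int g + 1 + int g div int d" by (simp add: zdiv_int)
    have G: "grid g m d = g # grid ?g m d" using False by (subst grid.simps) simp
    have "g div d \<le> g" by simp
    with False have le: "int ?g \<le> 2 * int m + 1" "int g div int d \<le> int g"
      by (linarith, simp add: zdiv_int[symmetric])
    from 1(1)[OF False 1(2) le(1)] obtain t where t: "t \<le> 30 * length (grid ?g m d) + 10"
      "\<And>Q. call W 7 [IntV (int ?g), IntV (int m), IntV (int d)] Q \<longleftrightarrow>
        Q (ints_val (map int (grid ?g m d))) t"
      by (auto elim!: computesE)
    have nn: "0 \<le> int g div int d" by (simp add: zdiv_int[symmetric])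
    from t(1) le[unfolded g] False 1(2) nn show ?thesis
      using t(2)[unfolded g]
      by (intro computesI) (simp_all add: program_nth grid_body_def wp_simps G)
  qed
qed

lemma computes_last_sol:
  assumes "Z \<noteq> []"
  shows "computes W 15 [table_val Z] (sol_val (snd (last Z))) (20 * length Z)"
  using assms
proof (induction Z)
  case (Cons z Z)
  show ?case
  proof (cases Z)
    case Nil
    then show ?thesis
      by (intro computesI) (simp_all add: program_nth last_sol_body_def wp_simps)
  next
    case (Cons y Y)
    with Cons.IH obtain t where "t \<le> 20 * length Z"
      "\<And>Q. call W 15 [table_val Z] Q \<longleftrightarrow> Q (sol_val (snd (last Z))) t"
      by (auto elim: computesE)
    with Cons show ?thesis
      by (intro computesI) (simp_all add: program_nth last_sol_body_def wp_simps)
  qed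
qed simp

lemma computes_sol_list:
  assumes "1 \<le> W" "0 \<notin> sol_set s"
  shows "computes W 16 [sol_val s, output_val acc] (output_val (sol_list s acc)) (30 * sol_size s)"
  using assms
proof (induction s acc rule: sol_list.induct)
  case (1 acc)
  show ?case by (rule computesI) (simp_all add: program_nth sol_list_body_def wp_simps)
next
  case (2 i acc)
  then show ?case
    by (intro computesI) (simp_all add: program_nth sol_list_body_def wp_simps output_val_def)
next
  case (3 a b acc)
  from 3 obtain t where "t \<le> 30 * sol_size a"
    "\<And>Q. call W 16 [sol_val a, output_val (sol_list b acc)] Q \<longleftrightarrow>
      Q (output_val (sol_list a (sol_list b acc))) t"
    by (auto elim: computesE)
  moreover from 3 obtain t' where "t' \<le> 30 * sol_size b"
    "\<And>Q. call W 16 [sol_val b, output_val acc] Q \<longleftrightarrow> Q (output_val (sol_list b acc)) t'"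
    by (auto elim: computesE)
  ultimately show ?case
    using 3(3) by (intro computesI) (simp_all add: program_nth sol_list_body_def wp_simps)
qed

lemma computes_top_fitting:
  "computes W 17 [tree_val I t, IntV c] (output_val (top_fitting (elem_size I) c t))
    (40 * length (labels t))"
proof (induction t)
  case (Node x ts)
  show ?case
  proof (cases ts)
    case Nil
    then show ?thesis
      by (intro computesI) (simp_all add: program_nth top_fitting_body_def open_node_def wp_simps
          output_val_def)
  next
    case (Cons t ts')
    have "t \<in> set ts" using Cons by simp
    from Node.IH[OF this] obtain r where "r \<le> 40 * length (labels t)"
      "\<And>Q. call W 17 [tree_val I t, IntV c] Q \<longleftrightarrow> Q (output_val (top_fitting (elem_size I) c t)) r"
      by (auto elim!: computesE)
    with Cons show ?thesis
      by (intro computesI) (simp_all add: program_nth top_fitting_body_def open_node_def wp_simps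
          output_val_def)
  qed
qed

definition solve_val :: "view_instance \<Rightarrow> int \<Rightarrow> int list \<Rightarrow> nat rtree \<Rightarrow> val" where
  "solve_val I c G t = ConsV (IntV (total (profit I) t))
     (table_val (table_of (elem_size I) (profit I) c G t))"

text \<open>The budget of a node: its share in the merge at its parent, the insertion of its root
  into the table, and constant overhead.\<close>

abbreviation node_cost :: "int list \<Rightarrow> nat" where
  "node_cost G \<equiv> merge_cost G + 350 + 40 * length G"

text \<open>Each tree leaves \<open>merge_cost G + 150\<close> of its budget unspent: 30 go into the
  list step here, and the remaining \<open>merge_cost G + 120\<close> per child pay for
  \<open>merge_all\<close> at the parent.\<close>

lemma computes_solve_list:
  assumes "\<And>t. t \<in> set ts \<Longrightarrow> fits_word W I [t] \<Longrightarrow>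
      computes W 13 [tree_val I t, ints_val G, IntV c] (solve_val I c G t)
        (length (labels t) * node_cost G - (merge_cost G + 150))"
    and "fits_word W I ts"
  shows "computes W 14 [forest_val I ts, ints_val G, IntV c]
    (ConsV (IntV (forest_total (profit I) ts))
      (tables_val (map (table_of (elem_size I) (profit I) c G) ts)))
    (length (forest_labels ts) * node_cost G + 10 - length ts * (merge_cost G + 120))"
  using assms
proof (induction ts)
  case Nil
  then show ?case
    by (intro computesI) (simp_all add: program_nth solve_list_body_def wp_simps fits_word_Nil)
next
  case (Cons t ts)
  note fits = fits_word_Cons[OF Cons.prems(2)]
  define B N where "B = merge_cost G" and "N = node_cost G"
  have BN: "B + 350 \<le> N" by (simp add: B_def N_def)
  from Cons.prems(1)[of t] fits obtain r where
    r: "r \<le> length (labels t) * N - (B + 150)"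
    "\<And>Q. call W 13 [tree_val I t, ints_val G, IntV c] Q \<longleftrightarrow> Q (solve_val I c G t) r"
    unfolding B_def N_def by (auto elim: computesE)
  from Cons fits obtain r' where
    r': "r' \<le> length (forest_labels ts) * N + 10 - length ts * (B + 120)"
    "\<And>Q. call W 14 [forest_val I ts, ints_val G, IntV c] Q \<longleftrightarrow>
      Q (ConsV (IntV (forest_total (profit I) ts))
        (tables_val (map (table_of (elem_size I) (profit I) c G) ts))) r'"
    unfolding B_def N_def by (auto elim: computesE)
  have "N \<le> length (labels t) * N" using length_labels_pos[of t] by simp
  moreover have "length ts * (B + 120) \<le> length (forest_labels ts) * N"
    using length_forest_le[of ts] BN by (intro mult_mono) auto
  moreover have "length (forest_labels (t # ts)) * N = length (labels t) * N + length (forest_labels ts) * N"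
    "length (t # ts) * (B + 120) = B + 120 + length ts * (B + 120)"
    by (simp_all add: algebra_simps)
  ultimately have "r + r' + 30 \<le> length (forest_labels (t # ts)) * N + 10 - length (t # ts) * (B + 120)"
    using r(1) r'(1) BN by linarith
  with r(2) r'(2) fits show ?case
    unfolding B_def N_def
    by (intro computesI) (simp_all add: program_nth solve_list_body_def wp_simps solve_val_def)
qed

lemma computes_solve:
  assumes "0 \<le> W" "c + c \<le> W" "\<forall>g\<in>set G. \<forall>h\<in>set G. \<bar>g + h\<bar> \<le> W" "G \<noteq> []" "0 \<le> c"
    and "fits_word W I [t]" "\<forall>i\<in>set (labels t). 0 \<le> elem_size I i"
  shows "computes W 13 [tree_val I t, ints_val G, IntV c] (solve_val I c G t)
    (length (labels t) * node_cost G - (merge_cost G + 150))"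
  using assms(6,7)
proof (induction t)
  case (Node x ts)
  note fits = fits_word_Node[OF Node.prems(1)]
  define B N where "B = merge_cost G" and "N = node_cost G"
  have BN: "B + 350 + 40 * length G = N" by (simp add: B_def N_def)
  let ?tables = "map (table_of (elem_size I) (profit I) c G) ts"
  let ?Z = "merge_all c G ?tables"
  obtain r1 where r1: "r1 \<le> length (forest_labels ts) * N + 10 - length ts * (B + 120)"
    "\<And>Q. call W 14 [forest_val I ts, ints_val G, IntV c] Q \<longleftrightarrow>
      Q (ConsV (IntV (forest_total (profit I) ts)) (tables_val ?tables)) r1"
    using computes_solve_list[OF Node.IH fits(1)] Node.prems(2) unfolding B_def N_def
    by (auto elim: computesE)
  have "\<forall>Z\<in>set ?tables. bounded_table c G Z"
    using Node.prems(2) assms by (auto intro!: bounded_table_of)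
  from computes_merge_all[OF assms(1-3) this] obtain r2 where
    r2: "r2 \<le> length ?tables * (B + 120) + 20"
      "\<And>Q. call W 12 [tables_val ?tables, ints_val G, IntV c] Q \<longleftrightarrow> Q (table_val ?Z) r2"
    unfolding B_def by (auto elim!: computesE)
  obtain r3 where r3: "r3 \<le> 40 * length G + 10"
    "\<And>Q. call W 10 [IntV (elem_size I x), IntV (int x), IntV (total (profit I) (Node x ts)),
        ints_val G, table_val ?Z] Q \<longleftrightarrow>
      Q (table_val (insert_root (elem_size I x) x (total (profit I) (Node x ts)) G ?Z)) r3"
    using computes_insert_root[of W "elem_size I x" x "total (profit I) (Node x ts)" G ?Z]
    by (auto elim!: computesE)
  \<comment> \<open>Ensures that the truncated subtraction in the bound for \<open>r1\<close> is
    genuine, so that it cancels against the cost of merging the \<open>length ts\<close>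
    tables.\<close>
  have "length ts * (B + 120) \<le> length (forest_labels ts) * N"
    using length_forest_le[of ts] BN by (intro mult_mono) auto
  moreover have "length (labels (Node x ts)) * N = N + length (forest_labels ts) * N"
    by simp
  ultimately have "r1 + r2 + r3 + 100 \<le> length (labels (Node x ts)) * N - (B + 150)"
    using r1(1) r2(1) r3(1) BN by simp
  with r1(2) r2(2) r3(2) fits(2-4) show ?case
    unfolding B_def N_def
    by (intro computesI) (simp_all add: program_nth solve_body_def open_node_def wp_simps
        solve_val_def profit_def[symmetric] Let_def)
qed


section \<open>The approximation scheme\<close>

lemma max_int_nonneg: "0 \<le> max_int v"
  by (induction v) auto

lemma max_int_list_val: "v \<in> set vs \<Longrightarrow> max_int v \<le> max_int (list_val vs)"
  by (induction vs) (auto simp: le_max_iff_disj)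

lemma max_int_tree_val:
  assumes "i \<in> set (labels t)"
  shows "int i \<le> max_int (tree_val I t) \<and> freq I i \<le> max_int (tree_val I t) \<and>
    cost_R I i \<le> max_int (tree_val I t)"
  using assms
proof (induction t)
  case (Node x ts)
  show ?case
  proof (cases "i = x")
    case False
    with Node.prems obtain t where t: "t \<in> set ts" "i \<in> set (labels t)" by auto
    have "max_int (tree_val I t) \<le> max_int (forest_val I ts)"
      using t(1) by (intro max_int_list_val) auto
    also have "\<dots> \<le> max_int (tree_val I (Node x ts))" by simp
    finally show ?thesis using Node.IH[OF t] by linarith
  next
    case True
    have le: "max_int v \<le> max_int (tree_val I (Node x ts))"
      if "v \<in> set (map IntV [int x, elem_size I x, freq I x, cost_R I x, cost_A I x])" for v
      using max_int_list_val[OF that] by (simp only: tree_val.simps max_int.simps le_max_iff_disj simp_thms)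
    have "max_int (IntV (int x)) \<le> max_int (tree_val I (Node x ts))"
      "max_int (IntV (freq I x)) \<le> max_int (tree_val I (Node x ts))"
      "max_int (IntV (cost_R I x)) \<le> max_int (tree_val I (Node x ts))"
      by (rule le; simp)+
    then show ?thesis unfolding True max_int.simps(1) by linarith
  qed
qed

text \<open>Exceeds 2(h + 1)q/p, so that (h + 1)/d stays below half of p/q, which is at most
  \<epsilon>. As p/q is at least \<epsilon>/2, it is still of order (h + 1)/\<epsilon>.\<close>

definition refinement :: "nat \<Rightarrow> nat \<Rightarrow> nat \<Rightarrow> nat" where
  "refinement h p q = 1 + (2 * (h + 1) * q) div p"

text \<open>With \<open>x = 1 / d\<close> and \<open>N = h + 1\<close>, \<open>(1 + x) ^ N * (1 - N * x) \<le> (1 - x\<^sup>2) ^ N \<le> 1\<close>.\<close>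

lemma refinement_accuracy:
  assumes "represents_accuracy p q \<epsilon>" "0 < \<epsilon>" "\<epsilon> < 1"
  shows "(1 + 1 / real (refinement h p q)) ^ (h + 1) \<le> 1 + \<epsilon>"
proof -
  define d N x where "d = refinement h p q" and "N = h + 1" and "x = 1 / real d"
  have q: "0 < q" and lo: "\<epsilon> / 2 \<le> real p / real q" and hi: "real p / real q \<le> \<epsilon>"
    using assms(1) by (auto simp: represents_accuracy_def)
  have p: "0 < p" using lo assms(2) by (cases "p = 0") auto
  have d: "0 < d" by (simp add: d_def refinement_def)
  have "2 * N * q < d * p"
    unfolding d_def refinement_def N_def using dividend_less_div_times[OF p] by (simp add: algebra_simps)
  then have "real (2 * N * q) \<le> real (d * p)" by (simp only: of_nat_le_iff less_imp_le)
  then have "2 * real N / real d \<le> real p / real q"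
    using d q by (simp add: field_simps)
  also note hi
  finally have Nx: "real N * x \<le> \<epsilon> / 2" by (simp add: x_def mult.commute)
  have x: "0 \<le> x" "x \<le> 1" using d by (auto simp: x_def)
  have "(1 + x) ^ N * (1 - real N * x) \<le> (1 + x) ^ N * (1 - x) ^ N"
    using Bernoulli_inequality[of "- x" N] x by (intro mult_left_mono) auto
  also have "\<dots> = (1 - x * x) ^ N"
    by (simp add: power_mult_distrib[symmetric] algebra_simps)
  also have "\<dots> \<le> 1" using x by (intro power_le_one) (auto simp: mult_le_one)
  finally have "(1 + x) ^ N * (1 - real N * x) \<le> 1" .
  moreover have "(1 + x) ^ N * (1 - \<epsilon> / 2) \<le> (1 + x) ^ N * (1 - real N * x)"
    using Nx x by (intro mult_left_mono) auto
  ultimately have "(1 + x) ^ N * (1 - \<epsilon> / 2) \<le> 1" by simp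
  also have "1 \<le> (1 + \<epsilon>) * (1 - \<epsilon> / 2)"
    using mult_mono[of \<epsilon> 1 \<epsilon> \<epsilon>] assms(2,3) by (simp add: algebra_simps)
  finally show ?thesis
    using assms(3) by (simp add: d_def N_def x_def mult_le_cancel_right)
qed

text \<open>Positive height forces \<chi> to be at least 2, and \<open>m \<ge> 2\<close> makes the
  other logarithm at least 1, so additive constants are absorbed: d is at most 13 log \<chi> /
  \<epsilon>, log(m + 1) at most 2 log A, and 27 = 2 * 13 + 1. For \<open>m \<le> 1\<close> the grid
  has at most two points.\<close>

lemma length_grid_le_time_bound:
  assumes "represents_accuracy p q \<epsilon>" "0 < \<epsilon>" "\<epsilon> < 1" "0 < height t" "real m \<le> A"
  shows "real (length (grid 0 m (refinement (height t) p q))) \<le>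
    27 * max 1 (log 2 (real (chi t)) * log 2 A / \<epsilon>)"
proof (cases "m \<le> 1")
  case True
  then have "real (length (grid 0 m (refinement (height t) p q))) \<le> 2"
    using length_grid_le[of 0 m "refinement (height t) p q"] by linarith
  then show ?thesis by linarith
next
  case False
  define h d lc la where "h = height t" and "d = refinement h p q"
    and "lc = log 2 (real (chi t))" and "la = log 2 A"
  have q: "0 < q" and lo: "\<epsilon> / 2 \<le> real p / real q"
    using assms(1) by (auto simp: represents_accuracy_def)
  have p: "0 < p" using lo assms(2) by (cases "p = 0") auto
  have chi2: "2 ^ h \<le> (chi t)\<^sup>2" unfolding h_def by (rule two_power_height_le_chi)
  have "(2::nat) \<le> 2 ^ h"
    using power_increasing[of 1 h "2::nat"] assms(4) by (simp add: h_def)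
  with chi2 have "2 \<le> (chi t)\<^sup>2" by linarith
  then have chi: "2 \<le> chi t" by (cases "chi t < 2") (auto simp: less_2_cases_iff)
  then have lc: "1 \<le> lc" unfolding lc_def by simp
  have "real (2 ^ h) \<le> real ((chi t)\<^sup>2)" using chi2 by (simp only: of_nat_le_iff)
  then have "log 2 (2 ^ h) \<le> log 2 ((real (chi t))\<^sup>2)"
    using chi by (subst log_le_cancel_iff) auto
  then have h: "real h \<le> 2 * lc" using chi by (simp add: lc_def log_nat_power)
  have m: "2 \<le> real m" using False by simp
  then have la: "1 \<le> la" using assms(5) unfolding la_def by simp
  have "real m + 1 \<le> (real m)\<^sup>2"
    using mult_right_mono[OF m, of "real m"] m unfolding power2_eq_square by linarith
  then have "log 2 (real m + 1) \<le> log 2 ((real m)\<^sup>2)"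
    using m by (subst log_le_cancel_iff) auto
  also have "\<dots> = 2 * log 2 (real m)" using m by (simp add: log_nat_power)
  also have "\<dots> \<le> 2 * la" using m assms(5) unfolding la_def by simp
  finally have logm: "log 2 (real m + 1) \<le> 2 * la" .
  have "real ((2 * (h + 1) * q) div p) \<le> real (2 * (h + 1) * q) / real p"
    by (rule of_nat_div_le_of_nat)
  also have "\<dots> = 2 * (real h + 1) * (real q / real p)" by (simp add: algebra_simps add_divide_distrib)
  also have "\<dots> \<le> 2 * (real h + 1) * (2 / \<epsilon>)"
    using lo assms(2) p q by (intro mult_left_mono) (auto simp: field_simps)
  also have "\<dots> \<le> 2 * (3 * lc) * (2 / \<epsilon>)"
    using h lc assms(2) by (intro mult_right_mono) auto
  finally have "real d \<le> 1 + 12 * (lc / \<epsilon>)" by (simp add: d_def refinement_def)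
  moreover have lce: "1 \<le> lc / \<epsilon>" using lc assms(2,3) by (simp add: le_divide_eq)
  ultimately have d: "real d \<le> 13 * (lc / \<epsilon>)" by simp
  have "real (length (grid 0 m d)) \<le> 1 + real d * log 2 (real m + 1)"
    by (rule length_grid_log) (simp add: d_def refinement_def)
  also have "\<dots> \<le> 1 + 13 * (lc / \<epsilon>) * (2 * la)"
    using d logm lce m by (intro add_left_mono mult_mono) auto
  also have "\<dots> = 1 + 26 * (lc * la / \<epsilon>)" by simp
  also have "1 \<le> lc * la / \<epsilon>"
    using mult_mono[OF lce la] lce by simp
  finally have "real (length (grid 0 m d)) \<le> 27 * (lc * la / \<epsilon>)" by (simp add: mult.commute)
  also have "\<dots> \<le> 27 * max 1 (lc * la / \<epsilon>)" by simp
  finally show ?thesis by (simp add: d_def h_def lc_def la_def)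
qed

locale view_problem =
  fixes I :: view_instance and p q :: nat and W :: int
  assumes valid: "valid_instance I"
    and p_pos: "0 < p"
    and W_def: "W = word_bound 5 (input_vals I p q)"
begin

abbreviation "J \<equiv> ad_tree I"
abbreviation "n \<equiv> num_elems I"
abbreviation "m \<equiv> Max (max_int ` set (input_vals I p q))"

lemma labels_J: "distinct (labels J)" "set (labels J) = elems I"
  using valid by (auto simp: valid_instance_def)

lemma n_pos: "1 \<le> n"
  using length_labels_pos by (simp add: num_elems_def)

lemma elem_bounds:
  assumes "i \<in> elems I"
  shows "0 < elem_size I i" "0 \<le> freq I i" "0 \<le> cost_A I i" "cost_A I i < cost_R I i"
  using valid assms by (auto simp: valid_instance_def)

lemma profit_nonneg: "i \<in> elems I \<Longrightarrow> 0 \<le> profit I i"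
  using elem_bounds(2,4)[of i] by (simp add: profit_def)

lemma total_J: "total (profit I) J = sum (profit I) (elems I)"
  unfolding total_conv_sum_list by (simp add: sum_list_distinct_conv_sum_set labels_J)

lemma total_nonneg_J: "0 \<le> total (profit I) J"
  unfolding total_J by (intro sum_nonneg profit_nonneg)

lemma input_le_m: "v \<in> set (input_vals I p q) \<Longrightarrow> max_int v \<le> m"
  by (intro Max_ge) auto

lemma m_bounds:
  "0 \<le> m" "max_int (tree_val I J) \<le> m" "capacity I \<le> m" "int p \<le> m" "int q \<le> m" "int n \<le> m"
proof -
  show tree: "max_int (tree_val I J) \<le> m"
    by (rule input_le_m) (simp add: input_vals_def)
  then show "0 \<le> m" using max_int_nonneg[of "tree_val I J"] by linarith
  have "max_int (IntV (capacity I)) \<le> m" "max_int (IntV (int p)) \<le> m" "max_int (IntV (int q)) \<le> m"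
    by (rule input_le_m; simp add: input_vals_def)+
  then show "capacity I \<le> m" "int p \<le> m" "int q \<le> m" by auto
  \<comment> \<open>The labels are 1 to \<open>n\<close>, so the number of elements itself occurs as
    an integer in the input.\<close>
  have "n \<in> set (labels J)" using labels_J n_pos by (simp add: elems_def)
  from max_int_tree_val[OF this, of I] tree show "int n \<le> m" by linarith
qed

lemma total_le: "total (profit I) J \<le> m ^ 3"
proof -
  have "profit I i \<le> m * m" if i: "i \<in> elems I" for i
  proof -
    have "freq I i \<le> m" "cost_R I i - cost_A I i \<le> m"
      using max_int_tree_val[of i J I] m_bounds(2) elem_bounds[OF i] i labels_J by auto
    then show ?thesis
      unfolding profit_def using elem_bounds[OF i] m_bounds by (intro mult_mono) auto
  qed
  then have "total (profit I) J \<le> of_nat (card (elems I)) * (m * m)"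
    unfolding total_J by (rule sum_bounded_above)
  also have "\<dots> = int n * (m * m)" by (simp add: elems_def)
  also have "\<dots> \<le> m * (m * m)" using m_bounds by (intro mult_right_mono) auto
  finally show ?thesis by (simp add: power3_eq_cube)
qed

text \<open>The largest values are cubic: grid arguments up to \<open>2 * m ^ 3 + 1\<close>, with
  \<open>m ^ 3\<close> bounding n times a frequency times a cost. The exponent 5 leaves a factor (m
  + 2)^2 of at least 4 for the constants.\<close>

lemma W_bounds:
  "0 \<le> W" "2 \<le> W" "m \<le> W" "2 * m \<le> W" "2 * m ^ 3 + 1 \<le> W" "4 * (m + 1)\<^sup>2 + 1 \<le> W"
proof -
  define b where "b = 2 + m"
  have b: "2 \<le> b" "m + 1 \<le> b" "m \<le> b" using m_bounds by (auto simp: b_def)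
  have W: "W = b ^ 5" by (simp add: W_def word_bound_def b_def)
  have b2: "4 \<le> b\<^sup>2" using power_mono[OF b(1), of 2] by simp
  have b3: "b\<^sup>2 \<le> b ^ 3" "b \<le> b\<^sup>2"
    using b power_increasing[of 2 3 b] power_increasing[of 1 2 b] by auto
  have "4 * b ^ 3 \<le> b\<^sup>2 * b ^ 3" using b2 b by (intro mult_right_mono) auto
  then have W3: "4 * b ^ 3 \<le> W" by (simp add: W power_add[symmetric])
  show "0 \<le> W" "2 \<le> W" "m \<le> W" "2 * m \<le> W" using W3 b2 b3 b by linarith+
  have "m ^ 3 \<le> b ^ 3" using b m_bounds by (intro power_mono) auto
  with W3 b2 b3 show "2 * m ^ 3 + 1 \<le> W" by linarith
  have "4 * b\<^sup>2 * 2 \<le> 4 * b\<^sup>2 * b" using b by (intro mult_left_mono) auto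
  also have "4 * b\<^sup>2 * b = 4 * b ^ 3" by (simp add: power2_eq_square power3_eq_cube)
  finally have "8 * b\<^sup>2 \<le> W" using W3 by linarith
  moreover have "(m + 1)\<^sup>2 \<le> b\<^sup>2" using b m_bounds by (intro power_mono) auto
  ultimately show "4 * (m + 1)\<^sup>2 + 1 \<le> W" using b2 by linarith
qed

lemma fits_J: "fits_word W I [J]"
proof -
  have "\<bar>cost_R I i - cost_A I i\<bar> \<le> W" if i: "i \<in> elems I" for i
    using max_int_tree_val[of i J I] m_bounds W_bounds elem_bounds[OF i] i labels_J by auto
  then show ?thesis
    using W_bounds total_le m_bounds profit_nonneg labels_J zero_le_power[of m 3]
    by (auto simp: fits_word_def)
qed

definition P :: nat where "P = nat (total (profit I) J)"

lemma int_P: "int P = total (profit I) J"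
  using total_nonneg_J by (simp add: P_def)

definition d :: nat where "d = refinement (height J) p q"

definition G :: "int list" where "G = map int (grid 0 P d)"

lemma d_pos: "0 < d"
  by (simp add: d_def refinement_def)

lemma G_not_Nil: "G \<noteq> []"
  by (simp add: G_def grid_Cons)

sublocale view_table "elem_size I" "profit I" "capacity I" "int P" G "1 + 1 / real d"
proof
  show "0 \<le> capacity I" using valid by (simp add: valid_instance_def)
  show "sorted G"
    unfolding G_def sorted_map using sorted_grid[of 0 P d] by (simp add: sorted_map)
  show "\<exists>G'. G = 0 # G'" by (simp add: G_def grid_Cons)
  fix v assume v: "0 \<le> v" "v \<le> int P"
  then obtain u where u: "v = int u" "u \<le> P" by (metis nonneg_int_cases of_nat_le_iff)
  from grid_dense[of 0 u P d] u(2) d_pos obtain k where "k < length (grid 0 P d)"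
    "grid 0 P d ! k \<le> u" "real u \<le> (1 + 1 / real d) * real (grid 0 P d ! k)" by auto
  then show "\<exists>k<length G. G ! k \<le> v \<and> real_of_int v \<le> (1 + 1 / real d) * real_of_int (G ! k)"
    by (intro exI[of _ k]) (simp add: G_def u)
qed auto

definition Z :: table where
  "Z = table_of (elem_size I) (profit I) (capacity I) G J"

lemma is_table_Z: "is_table [J] (Suc (height J)) Z"
proof -
  have "is_forest [J]"
    unfolding is_forest_def using labels_J elem_bounds(1) profit_nonneg
    by (auto simp: less_imp_le int_P)
  then show ?thesis unfolding Z_def by (rule is_table_table_of)
qed

lemma Z_entry:
  assumes "k < length Z"
  shows "feasible I (sol_set (snd (Z ! k)))" "G ! k \<le> saving I (sol_set (snd (Z ! k)))"
    "0 \<notin> sol_set (snd (Z ! k))" "sol_size (snd (Z ! k)) \<le> 2 * n"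
proof -
  let ?S = "sol_set (snd (Z ! k))"
  have *: "fst (Z ! k) \<le> capacity I" "?S \<subseteq> set (labels J)"
      "sol_size (snd (Z ! k)) + 1 \<le> max 2 (2 * length (labels J))"
      "weight (elem_size I) ?S J \<le> fst (Z ! k)" "G ! k \<le> covered (profit I) ?S J"
    using is_table_Z assms unfolding is_table_def by auto
  then have S: "?S \<subseteq> elems I" using labels_J by simp
  with * show "feasible I ?S" using feasible_iff_weight[OF valid] by auto
  show "G ! k \<le> saving I ?S" using * saving_eq_covered[OF valid S] by simp
  show "0 \<notin> ?S" using S by (auto simp: elems_def)
  show "sol_size (snd (Z ! k)) \<le> 2 * n" using * n_pos by (simp add: num_elems_def)
qed

lemma Z_optimal:
  assumes "feasible I M"
  shows "\<exists>k<length Z. real_of_int (saving I M) \<le> (1 + 1 / real d) ^ Suc (height J) * real_of_int (G ! k)"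
proof -
  have "M \<subseteq> elems I" "weight (elem_size I) M J \<le> capacity I"
    using assms feasible_iff_weight[OF valid] by auto
  with is_table_Z saving_eq_covered[OF valid] show ?thesis
    unfolding is_table_def by auto
qed

text \<open>The grid increases, so the last entry guarantees at least as much as the entry matching
  an optimal selection, and every entry respects the capacity.\<close>

lemma approx_last:
  assumes "represents_accuracy p q \<epsilon>" "0 < \<epsilon>" "\<epsilon> < 1"
  shows "Z \<noteq> []" "approx_solution I \<epsilon> (sol_set (snd (last Z)))"
proof -
  obtain M where M: "feasible I M" "saving I M = opt_saving I"
    using opt_saving_attained[OF valid] by blast
  from Z_optimal[OF M(1)] obtain k where k: "k < length Z"
    "real_of_int (opt_saving I) \<le> (1 + 1 / real d) ^ Suc (height J) * real_of_int (G ! k)"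
    unfolding M(2) by blast
  then show ne: "Z \<noteq> []" by auto
  let ?l = "length Z - 1"
  have l: "?l < length Z" "last Z = Z ! ?l" using ne by (auto simp: last_conv_nth)
  have len: "length Z \<le> length G" using is_table_Z by (simp add: is_table_def)
  have "G ! k \<le> G ! ?l" using grid_sorted k(1) l(1) len by (intro sorted_nth_mono) auto
  with Z_entry(2)[OF l(1)] have Gk: "G ! k \<le> saving I (sol_set (snd (last Z)))" by (simp add: l(2))
  have "0 \<le> G ! k" using grid_nonneg k(1) len by simp
  note k(2)
  also have "(1 + 1 / real d) ^ Suc (height J) * real_of_int (G ! k) \<le> (1 + \<epsilon>) * real_of_int (G ! k)"
    using refinement_accuracy[OF assms, of "height J"] \<open>0 \<le> G ! k\<close>
    by (intro mult_right_mono) (auto simp: d_def)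
  also have "\<dots> \<le> (1 + \<epsilon>) * real_of_int (saving I (sol_set (snd (last Z))))"
    using Gk assms(2) by (intro mult_left_mono) auto
  finally show "approx_solution I \<epsilon> (sol_set (snd (last Z)))"
    using Z_entry(1)[OF l(1)] by (simp add: approx_solution_def l(2))
qed

lemma computes_height_J:
  obtains r where "r \<le> 150 * n" "\<And>Q. call W 3 [tree_val I J] Q \<longleftrightarrow> Q (IntV (int (height J))) r"
proof -
  have "2 * int (length (labels J)) \<le> W"
    using m_bounds W_bounds unfolding num_elems_def by linarith
  from computes_height[OF this, of I] obtain r where
    "r \<le> 150 * length (labels J) - 60"
    "\<And>Q. call W 3 [tree_val I J] Q \<longleftrightarrow> Q (IntV (int (height J))) r"
    by (auto elim!: computesE)
  then show thesis by (intro that[of r]) (auto simp: num_elems_def)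
qed

lemma computes_main_path:
  assumes "height J = 0"
  shows "computes W 0 (input_vals I p q) (output_val (top_fitting (elem_size I) (capacity I) J)) (240 * n)"
proof -
  obtain r1 where r1: "r1 \<le> 150 * n" "\<And>Q. call W 3 [tree_val I J] Q \<longleftrightarrow> Q (IntV (int (height J))) r1"
    using computes_height_J by blast
  obtain r2 where r2: "r2 \<le> 40 * n"
    "\<And>Q. call W 17 [tree_val I J, IntV (capacity I)] Q \<longleftrightarrow>
      Q (output_val (top_fitting (elem_size I) (capacity I) J)) r2"
    using computes_top_fitting[of W I J "capacity I"] by (auto simp: num_elems_def elim!: computesE)
  from r1 r2 assms W_bounds(1,2) n_pos show ?thesis
    by (intro computesI) (simp_all add: program_nth main_body_def wp_simps input_vals_def)
qed

lemma node_cost_le: "node_cost G \<le> 630 * (length G)\<^sup>2"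
proof -
  have "1 \<le> length G" using G_not_Nil by (simp add: Suc_le_eq)
  then have "length G \<le> (length G)\<^sup>2" "1 \<le> (length G)\<^sup>2" by (auto simp: power2_eq_square)
  moreover have "node_cost G = 120 * (length G)\<^sup>2 + 100 * length G + 370"
    by (simp add: algebra_simps power2_eq_square)
  ultimately show ?thesis by linarith
qed

lemma computes_main_tree:
  assumes "0 < height J" "Z \<noteq> []"
  shows "computes W 0 (input_vals I p q) (output_val (sol_list (snd (last Z)) [])) (1100 * n * (length G)\<^sup>2)"
proof -
  define K where "K = length G"
  let ?h = "height J" and ?s = "snd (last Z)"
  obtain r1 where r1: "r1 \<le> 150 * n" "\<And>Q. call W 3 [tree_val I J] Q \<longleftrightarrow> Q (IntV (int ?h)) r1"
    using computes_height_J by blast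
  obtain r2 where r2: "r2 \<le> 80 * n"
    "\<And>Q. call W 1 [tree_val I J] Q \<longleftrightarrow> Q (IntV (int P)) r2"
    using computes_mono[OF computes_total[OF fits_J], of "80 * n"]
    unfolding int_P by (auto simp: num_elems_def elim!: computesE)
  have P: "int P \<le> m ^ 3" using total_le by (simp add: int_P)
  have "computes W 7 [IntV (int 0), IntV (int P), IntV (int d)] (ints_val G) (30 * K + 10)"
    unfolding G_def K_def length_map using P W_bounds by (intro computes_grid) auto
  then obtain r3 where r3: "r3 \<le> 30 * K + 10"
    "\<And>Q. call W 7 [IntV (int 0), IntV (int P), IntV (int d)] Q \<longleftrightarrow> Q (ints_val G) r3"
    by (auto elim!: computesE)
  have d: "int d = 1 + (2 * (int ?h + 1) * int q) div int p"
    by (simp add: d_def refinement_def zdiv_int algebra_simps)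
  have G: "0 \<le> g \<and> g \<le> int P" if "g \<in> set G" for g
    using that grid_less[of _ 0 P d] by (auto simp: G_def)
  have gh: "\<forall>g\<in>set G. \<forall>h\<in>set G. \<bar>g + h\<bar> \<le> W"
  proof (intro ballI)
    fix g h assume "g \<in> set G" "h \<in> set G"
    with G[of g] G[of h] P W_bounds show "\<bar>g + h\<bar> \<le> W" by linarith
  qed
  have "computes W 13 [tree_val I J, ints_val G, IntV (capacity I)] (solve_val I (capacity I) G J)
    (length (labels J) * node_cost G - (merge_cost G + 150))"
    using W_bounds m_bounds gh G_not_Nil c_nonneg fits_J elem_bounds(1) labels_J
    by (intro computes_solve) (auto simp: less_imp_le)
  then obtain r4 where r4: "r4 \<le> n * node_cost G"
    "\<And>Q. call W 13 [tree_val I J, ints_val G, IntV (capacity I)] Q \<longleftrightarrow>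
      Q (ConsV (IntV (total (profit I) J)) (table_val Z)) r4"
    unfolding solve_val_def Z_def[symmetric] num_elems_def
    by (auto elim!: computesE dest: le_trans[OF _ diff_le_self])
  obtain r5 where r5: "r5 \<le> 20 * length Z"
    "\<And>Q. call W 15 [table_val Z] Q \<longleftrightarrow> Q (sol_val ?s) r5"
    using computes_last_sol[OF assms(2), of W] by (auto elim!: computesE)
  have last: "last Z = Z ! (length Z - 1)" "length Z - 1 < length Z"
    using assms(2) by (auto simp: last_conv_nth)
  have "0 \<notin> sol_set ?s" "sol_size ?s \<le> 2 * n" using Z_entry[OF last(2)] by (simp_all add: last(1))
  then obtain r6 where r6: "r6 \<le> 30 * (2 * n)"
    "\<And>Q. call W 16 [sol_val ?s, NilV] Q \<longleftrightarrow> Q (output_val (sol_list ?s [])) r6"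
    using computes_mono[OF computes_sol_list[of W ?s "[]"], of "30 * (2 * n)"] W_bounds
    by (auto simp: output_val_def elim!: computesE)
  \<comment> \<open>The intermediate results in the computation of \<open>d\<close> have to fit in a
    word; they are quadratic in the input, as \<open>height J \<le> 2 * m\<close> and
    \<open>q \<le> m\<close>.\<close>
  have arith: "\<bar>int ?h + 1\<bar> \<le> W" "\<bar>2 * (int ?h + 1)\<bar> \<le> W" "\<bar>2 * (int ?h + 1) * int q\<bar> \<le> W"
    "\<bar>(2 * (int ?h + 1) * int q) div int p\<bar> \<le> W" "\<bar>1 + (2 * (int ?h + 1) * int q) div int p\<bar> \<le> W"
  proof -
    let ?x = "2 * (int ?h + 1)"
    have "int ?h \<le> 2 * m"
      using height_le[of J] m_bounds unfolding num_elems_def by linarith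
    then have x: "0 \<le> ?x" "?x \<le> 4 * (m + 1)" by auto
    have "?x * int q \<le> 4 * (m + 1) * (m + 1)"
      by (rule mult_mono) (use x m_bounds in auto)
    also have "\<dots> = 4 * (m + 1)\<^sup>2" by (simp add: power2_eq_square)
    finally have y: "?x * int q \<le> 4 * (m + 1)\<^sup>2" .
    have "4 * (m + 1) * 1 \<le> 4 * (m + 1) * (m + 1)" using m_bounds by (intro mult_left_mono) auto
    also have "\<dots> = 4 * (m + 1)\<^sup>2" by (simp add: power2_eq_square)
    finally have "?x \<le> 4 * (m + 1)\<^sup>2" using x(2) by linarith
    then have "?x \<le> W" using W_bounds(6) by linarith
    then show "\<bar>int ?h + 1\<bar> \<le> W" "\<bar>?x\<bar> \<le> W" by (simp_all add: abs_le_iff)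
    have "0 \<le> ?x * int q" using x by (intro mult_nonneg_nonneg) auto
    moreover have "(?x * int q) div int p \<le> ?x * int q"
      using calculation p_pos zdiv_mono2[of "?x * int q" 1 "int p"] by simp
    moreover have "0 \<le> (?x * int q) div int p"
      using calculation p_pos by (simp add: pos_imp_zdiv_nonneg_iff)
    ultimately show "\<bar>?x * int q\<bar> \<le> W" "\<bar>(?x * int q) div int p\<bar> \<le> W"
      "\<bar>1 + (?x * int q) div int p\<bar> \<le> W"
      using y W_bounds by linarith+
  qed
  have "1 \<le> K" using G_not_Nil by (simp add: K_def Suc_le_eq)
  then have K: "K \<le> K\<^sup>2" "1 \<le> K\<^sup>2" by (auto simp: power2_eq_square)
  have "n \<le> n * K\<^sup>2" "K\<^sup>2 \<le> n * K\<^sup>2" using K n_pos by auto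
  moreover have "n * node_cost G \<le> n * (630 * K\<^sup>2)"
    using node_cost_le unfolding K_def by (rule mult_le_mono2)
  moreover have "length Z \<le> K" using is_table_Z by (simp add: is_table_def K_def)
  \<comment> \<open>Measured in units of \<open>n * K\<^sup>2\<close>, the contributions are at most
    150 + 80 + 40 + 630 + 20 + 60 and 60 for the body, in all 1040.\<close>
  ultimately have time: "r1 + r2 + r3 + r4 + r5 + r6 + 60 \<le> 1100 * n * K\<^sup>2"
    using r1(1) r2(1) r3(1) r4(1) r5(1) r6(1) n_pos K by linarith
  show ?thesis
    using r1(2) r2(2) r3(2)[unfolded d] r4(2) r5(2) r6(2) arith assms(1) W_bounds(1,2) time
    unfolding K_def[symmetric]
    by (intro computesI) (simp_all add: program_nth main_body_def wp_simps input_vals_def)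
qed

lemma run_computes:
  assumes "computes W 0 (input_vals I p q) v T"
  obtains t where "t \<le> T" "run W program (input_vals I p q) v t"
  using assms by (auto simp: computes_def runs_def run_def)

text \<open>The selection is optimal outright; its saving is nonnegative, so the factor 1 +
  \<epsilon> does no harm.\<close>

lemma approx_path:
  assumes "height J = 0" "0 < \<epsilon>"
  shows "approx_solution I \<epsilon> (set (top_fitting (elem_size I) (capacity I) J))"
proof -
  let ?S = "set (top_fitting (elem_size I) (capacity I) J)"
  have opt: "?S \<subseteq> set (labels J) \<and> weight (elem_size I) ?S J \<le> capacity I \<and>
    (\<forall>M. weight (elem_size I) M J \<le> capacity I \<longrightarrow> covered (profit I) M J \<le> covered (profit I) ?S J)"
    using labels_J elem_bounds(1) profit_nonneg c_nonneg
    by (intro top_fitting_optimal[OF assms(1)]) (auto simp: less_imp_le)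
  then have S: "?S \<subseteq> elems I" using labels_J by simp
  with opt have "feasible I ?S" using feasible_iff_weight[OF valid] by auto
  obtain M where M: "feasible I M" "saving I M = opt_saving I"
    using opt_saving_attained[OF valid] by blast
  then have "M \<subseteq> elems I" "weight (elem_size I) M J \<le> capacity I"
    using feasible_iff_weight[OF valid] by auto
  with opt M saving_eq_covered[OF valid] S have "opt_saving I \<le> saving I ?S" by metis
  moreover have "0 \<le> saving I ?S"
  proof -
    have "covered (profit I) {} J \<le> covered (profit I) ?S J"
      using opt c_nonneg by (auto simp: weight_def)
    then show ?thesis using saving_eq_covered[OF valid S] by (simp add: covered_empty)
  qed
  then have "0 \<le> \<epsilon> * real_of_int (saving I ?S)" using assms(2) by simp
  ultimately show ?thesis
    using \<open>feasible I ?S\<close> by (simp add: approx_solution_def algebra_simps)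
qed

lemma P_le:
  assumes "real_of_int (\<Sum>i\<in>elems I. freq I i * cost_R I i) \<le> A"
  shows "real P \<le> A"
proof -
  have "int P \<le> (\<Sum>i\<in>elems I. freq I i * cost_R I i)"
    unfolding int_P total_J profit_def
    using elem_bounds by (intro sum_mono mult_left_mono) auto
  then have "real_of_int (int P) \<le> real_of_int (\<Sum>i\<in>elems I. freq I i * cost_R I i)"
    by (simp only: of_int_le_iff)
  with assms show ?thesis by simp
qed

end

theorem theorem3:
  "\<exists>(P :: prog) (k :: nat) (C :: real).
     \<forall>(I :: view_instance) (a :: nat \<Rightarrow> real) (\<epsilon> :: real) (p :: nat) (q :: nat).
       valid_instance I \<and>
       real_of_int (\<Sum>i\<in>elems I. freq I i * cost_R I i) \<le> a (num_elems I) \<and>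
       0 < \<epsilon> \<and> \<epsilon> < 1 \<and> represents_accuracy p q \<epsilon> \<longrightarrow>
       (\<exists>(sel :: nat list) (t :: nat).
          run (word_bound k (input_vals I p q)) P (input_vals I p q) (output_val sel) t \<and>
          approx_solution I \<epsilon> (set sel) \<and>
          real t \<le> C * time_bound (num_elems I) (chi (ad_tree I)) (a (num_elems I)) \<epsilon>)"
\<comment> \<open>801900 is 1100 * 27^2: the constant of the main computation times the square of
  the one for the grid length.\<close>
proof (rule exI[of _ program], rule exI[of _ 5], rule exI[of _ 801900], intro allI impI)
  fix I :: view_instance and a :: "nat \<Rightarrow> real" and \<epsilon> :: real and p q :: nat
  assume asm: "valid_instance I \<and>
       real_of_int (\<Sum>i\<in>elems I. freq I i * cost_R I i) \<le> a (num_elems I) \<and>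
       0 < \<epsilon> \<and> \<epsilon> < 1 \<and> represents_accuracy p q \<epsilon>"
  then have acc: "represents_accuracy p q \<epsilon>" "0 < \<epsilon>" "\<epsilon> < 1" by auto
  then have "0 < p" by (cases "p = 0") (auto simp: represents_accuracy_def)
  with asm interpret view_problem I p q "word_bound 5 (input_vals I p q)"
    by unfold_locales auto
  define L where "L = max 1 (log 2 (real (chi J)) * log 2 (a n) / \<epsilon>)"
  have L: "1 \<le> L" and bound: "time_bound n (chi J) (a n) \<epsilon> = real n * L\<^sup>2"
    by (simp_all add: L_def time_bound_def)
  show "\<exists>sel t. run (word_bound 5 (input_vals I p q)) program (input_vals I p q) (output_val sel) t \<and>
    approx_solution I \<epsilon> (set sel) \<and> real t \<le> 801900 * time_bound n (chi J) (a n) \<epsilon>"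
  proof (cases "height J = 0")
    case True
    from run_computes[OF computes_main_path[OF True]] obtain t where t: "t \<le> 240 * n"
      "run (word_bound 5 (input_vals I p q)) program (input_vals I p q)
        (output_val (top_fitting (elem_size I) (capacity I) J)) t" by blast
    \<comment> \<open>Without branching the logarithm of \<chi> vanishes, and the maximum with 1 in
      the time bound supplies the linear term.\<close>
    have "real n * 1 \<le> real n * L\<^sup>2" using L by (intro mult_left_mono) auto
    with t(1) have "real t \<le> 801900 * (real n * L\<^sup>2)" by linarith
    with t(2) approx_path[OF True acc(2)] show ?thesis unfolding bound by blast
  next
    case False
    note Z = approx_last[OF acc]
    from run_computes[OF computes_main_tree[OF _ Z(1)]] False obtain t where
      t: "t \<le> 1100 * n * (length G)\<^sup>2"
      "run (word_bound 5 (input_vals I p q)) program (input_vals I p q)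
        (output_val (sol_list (snd (last Z)) [])) t" by blast
    have "real (length G) \<le> 27 * L"
      using length_grid_le_time_bound[OF acc, of J P "a n"] False P_le asm
      by (simp add: G_def d_def L_def)
    then have "(real (length G))\<^sup>2 \<le> (27 * L)\<^sup>2" by (intro power_mono) auto
    then have "1100 * real n * (real (length G))\<^sup>2 \<le> 1100 * real n * (729 * L\<^sup>2)"
      by (intro mult_left_mono) (auto simp: power_mult_distrib)
    moreover have "real t \<le> 1100 * real n * (real (length G))\<^sup>2"
    proof -
      have "real t \<le> real (1100 * n * (length G)\<^sup>2)" using t(1) by (simp only: of_nat_le_iff)
      then show "real t \<le> 1100 * real n * (real (length G))\<^sup>2" by simp
    qed
    ultimately have "real t \<le> 801900 * (real n * L\<^sup>2)" by (simp add: algebra_simps)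
    with t(2) Z(2) show ?thesis
      unfolding bound by (intro exI[of _ "sol_list (snd (last Z)) []"] exI[of _ t]) (auto simp: set_sol_list)
  qed
qed

end
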